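(* Let $d,k$ be positive integers. If $\varphi:[-1,1]\times[0,\infty)\to\mathbb{R}$ belongs to $\mathcal{P}(\mathbb{S}^d\times\mathbb{R}^k)$, then the function $D_1\varphi$ defined by $$D_1\varphi(x,t):=\frac{\partial\varphi}{\partial x}(x,t),\qquad (x,t)\in[-1,1]\times[0,\infty),$$ belongs to $\mathcal{P}(\mathbb{S}^{d+2}\times\mathbb{R}^k)$.
   Context: $\mathbb{S}^d$ is the unit sphere of $\mathbb{R}^{d+1}$, with geodesic distance $\theta(x,x')=\arccos\langle x,x'\rangle$; $\|\cdot\|$ is the Euclidean norm on $\mathbb{R}^k$. A function $C:(X\times Y)^2\to\mathbb{R}$ is positive definite if $\sum_{i,j=1}^N a_i\,C((x_i,y_i),(x_j,y_j))\,a_j\ge 0$ for all finite systems of reals $a_1,\dots,a_N$ and points $(x_1,y_1),\dots,(x_N,y_N)\in X\times Y$. $\mathcal{P}(\mathbb{S}^d\times\mathbb{R}^k)$ is the class of continuous functions $\varphi:[-1,1]\times[0,\infty)\to\mathbb{R}$ such that $C((x,y),(x',y'))=\varphi(\cos\theta(x,x'),\|y-y'\|)$ is positive definite on $\mathbb{S}^d\times\mathbb{R}^k$. It is known (Berg–Porcu) that every $\varphi\in\mathcal{P}(\mathbb{S}^d\times\mathbb{R}^k)$ is continuously differentiable with respect to its first variable; the paper takes this as the meaning under which $D_1\varphi$ is defined.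
   Formalization: The existence of the partial derivative of φ in x on all of [-1,1]×[0,∞) (one-sided at x=±1) is assumed; it can fail for members of the class, e.g. φ(cos θ,t)=Σ cos(nθ)/n² with d=1 has no derivative at x=1. *)

theory Defs
  imports "HOL-Analysis.Analysis"
begin

definition geodist :: "'a::real_inner \<Rightarrow> 'a \<Rightarrow> real" where
  "geodist x x' = arccos (x \<bullet> x')"

definition positive_definite_on :: "'p set \<Rightarrow> ('p \<Rightarrow> 'p \<Rightarrow> real) \<Rightarrow> bool" where
  "positive_definite_on A C \<longleftrightarrow>
     (\<forall>(N::nat) (a::nat \<Rightarrow> real) (p::nat \<Rightarrow> 'p).
        (\<forall>i<N. p i \<in> A) \<longrightarrow> 0 \<le> (\<Sum>i<N. \<Sum>j<N. a i * C (p i) (p j) * a j))"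

text \<open>
  The class of all \<open>\<phi>\<close> inducing positive definite kernels on \<open>S\<^sup>d \<times> \<real>\<^sup>k\<close>, where
  \<open>S\<^sup>d\<close> is the unit sphere of a Euclidean space \<open>'a\<close> with \<open>DIM('a) = d + 1\<close> and
  \<open>\<real>\<^sup>k\<close> is a Euclidean space \<open>'b\<close> with \<open>DIM('b) = k\<close>. A function on
  \<open>[-1, 1] \<times> [0, \<infinity>)\<close> is represented by a total function whose values outside that
  domain are irrelevant.
\<close>

definition pd_class ::
  "'a::euclidean_space itself \<Rightarrow> 'b::euclidean_space itself \<Rightarrow> (real \<Rightarrow> real \<Rightarrow> real) set"
where
  "pd_class _ _ = {\<phi>.
     continuous_on ({-1..1} \<times> {0..}) (\<lambda>(x, t). \<phi> x t) \<and>
     positive_definite_on (sphere (0::'a) 1 \<times> (UNIV::'b set))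
       (\<lambda>(x, y) (x', y'). \<phi> (cos (geodist x x')) (norm (y - y')))}"

text \<open>
  The partial derivative in the first variable is taken within \<open>[-1, 1]\<close>, hence it is
  one-sided at the end points.
\<close>

definition D1 :: "(real \<Rightarrow> real \<Rightarrow> real) \<Rightarrow> real \<Rightarrow> real \<Rightarrow> real" where
  "D1 \<phi> x t = vector_derivative (\<lambda>s. \<phi> s t) (at x within {-1..1})"

text \<open>
  Existence of the partial derivative on all of \<open>[-1, 1] \<times> [0, \<infinity>)\<close>. It is not automatic
  for members of the class, e.g. the sum of \<open>cos (n * arccos x) / n\<^sup>2\<close> over \<open>n \<ge> 1\<close>, constant
  in \<open>t\<close>, belongs to the class of \<open>S\<^sup>1 \<times> \<real>\<^sup>k\<close> but has no derivative at \<open>x = 1\<close>.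
  Continuity of the derivative is not required here.
\<close>

definition differentiable_in_first :: "(real \<Rightarrow> real \<Rightarrow> real) \<Rightarrow> bool" where
  "differentiable_in_first \<phi> \<longleftrightarrow> (\<forall>t\<ge>0. (\<lambda>s. \<phi> s t) differentiable_on {-1..1})"

end

theory Submission
  imports Defs "HOL-Computational_Algebra.Polynomial"
begin

text \<open>
  Put \<open>a = d - 1\<close> and let \<open>P\<^sub>n\<close> be the ultraspherical polynomials of \<open>S\<^sup>d\<close> with
  \<open>P\<^sub>n 1 = 1\<close>. The proof rests on Schoenberg's expansion
  \<open>\<phi> x t = \<Sum>n. c\<^sub>n t * P\<^sub>n x\<close>, in which every \<open>c\<^sub>n\<close> is a continuous positive definite radial
  function on \<open>\<real>\<^sup>k\<close> and \<open>\<Sum>n. c\<^sub>n 0\<close> converges. Differentiation turns \<open>P\<^sub>n\<close> into a nonnegative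
  multiple of an ultraspherical polynomial of \<open>S\<^sup>d\<^sup>+\<^sup>2\<close> (\<open>pderiv_usp\<close>), which induces a positive
  definite kernel there; so, by the Schur product theorem, the differentiated series has positive
  definite terms. It converges uniformly: its terms are bounded by \<open>c\<^sub>n 0 * P\<^sub>n' 1\<close>, and the sum of
  these numbers is at most the derivative of \<open>\<phi> x 0\<close> at \<open>x = 1\<close> (\<open>summable_usp_coeff_pderiv\<close>).

  The expansion is obtained without integration on the sphere, from three ingredients.

  The kernel \<open>P\<^sub>n (x \<bullet> y)\<close> is a finite sum of products \<open>u x * u y\<close> with polynomial functions
  \<open>u\<close> (\<open>polynomial_gram_usp\<close>). This is proved by induction on \<open>n\<close>: first-order differential
  operators applied to the functions \<open>u\<close> in degree \<open>n\<close> give those in degree \<open>n + 1\<close>.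

  If a continuous function \<open>g\<close> on \<open>[-1, 1]\<close> induces a positive definite kernel on the sphere, then
  its integral against the ultraspherical weight is nonnegative (\<open>usp_int_nonneg_if_pd\<close>). For this,
  \<open>g\<close> is approximated by a polynomial \<open>c + \<Delta>q\<close>, where \<open>\<Delta>\<close> is the spherical Laplacian on zonal
  functions. The maximum principle provides points on the sphere for which the means over all pairs
  of \<open>\<Delta>q\<close> are asymptotically at most \<open>0\<close>, so that \<open>c\<close>, the weighted mean of the polynomial, is
  nonnegative up to the error of the approximation. Applied to \<open>\<phi>\<close> times \<open>P\<^sub>n\<close>, this shows that
  the coefficients \<open>c\<^sub>n\<close> are positive definite (\<open>usp_coeff_pd\<close>).

  A continuous function with nonnegative ultraspherical coefficients is nonnegative at \<open>1\<close>
  (\<open>usp_coeffs_nonneg_at_1\<close>), which bounds the partial sums of \<open>\<Sum>n. c\<^sub>n 0\<close>; and it vanishes if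
  all its coefficients do (\<open>usp_coeffs_eq_0_imp\<close>), which identifies the sum of the series.
\<close>

section \<open>Ultraspherical polynomials\<close>

text \<open>
  The ultraspherical (Gegenbauer) polynomial of degree \<open>n\<close> that belongs to the sphere
  \<open>S\<^sup>a\<^sup>+\<^sup>1\<close> of a Euclidean space of dimension \<open>a + 2\<close>, normalised to take the value \<open>1\<close> at \<open>1\<close>;
  thus \<open>a = 0\<close> gives the Chebyshev and \<open>a = 1\<close> the Legendre polynomials. The defining
  recursion is the raising relation
  \<open>P\<^sub>n\<^sub>+\<^sub>1 = t P\<^sub>n - (1 - t\<^sup>2) P\<^sub>n' / (n + a)\<close>. For \<open>n = a = 0\<close> the quotient has denominator \<open>0\<close>
  and is read as \<open>0\<close>, which gives the correct \<open>P\<^sub>1 = t\<close>.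
\<close>

fun usp :: "nat \<Rightarrow> nat \<Rightarrow> real poly" where
  "usp a 0 = 1"
| "usp a (Suc n) = [:0, 1:] * usp a n - smult (1 / real (n + a)) ([:1, 0, -1:] * pderiv (usp a n))"

declare usp.simps(2) [simp del]

lemma usp_one: "usp a (Suc 0) = [:0, 1:]"
  by (simp add: usp.simps(2))

lemma poly_usp_Suc:
  "poly (usp a (Suc n)) t =
     t * poly (usp a n) t - (1 - t\<^sup>2) * poly (pderiv (usp a n)) t / (real n + real a)"
  by (simp add: usp.simps(2) power2_eq_square algebra_simps add_divide_distrib diff_divide_distrib)

lemma poly_pderiv_usp_Suc_raw:
  "poly (pderiv (usp a (Suc n))) t =
     poly (usp a n) t + t * poly (pderiv (usp a n)) t
     + (2 * t * poly (pderiv (usp a n)) t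
        - (1 - t\<^sup>2) * poly (pderiv (pderiv (usp a n))) t) / (real n + real a)"
  by (simp add: usp.simps(2) pderiv_mult pderiv_diff pderiv_add pderiv_minus pderiv_smult pderiv_pCons
      power2_eq_square algebra_simps add_divide_distrib diff_divide_distrib)

lemma poly_usp_at_1 [simp]: "poly (usp a n) 1 = 1"
  by (induction n) (auto simp: poly_usp_Suc)

text \<open>
  The differential equation of the ultraspherical polynomials, proved by induction. The formula
  for \<open>P\<^sub>n\<^sub>+\<^sub>1'\<close> is what the differential equation for \<open>P\<^sub>n\<close> makes of the derivative of the
  recursion, and one more derivative gives the equation for \<open>P\<^sub>n\<^sub>+\<^sub>1\<close>.
\<close>

lemma
  shows usp_ode: "(1 - t\<^sup>2) * poly (pderiv (pderiv (usp a n))) t =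
      (real a + 1) * t * poly (pderiv (usp a n)) t - real n * (real n + real a) * poly (usp a n) t"
    and poly_pderiv_usp_Suc: "poly (pderiv (usp a (Suc n))) t =
      (real n + 1) * (poly (usp a n) t + t * poly (pderiv (usp a n)) t / (real n + real a))"
proof -
  have step: "poly (pderiv (usp a (Suc n))) t =
      (real n + 1) * (poly (usp a n) t + t * poly (pderiv (usp a n)) t / (real n + real a))"
    if ode: "\<And>t. (1 - t\<^sup>2) * poly (pderiv (pderiv (usp a n))) t =
      (real a + 1) * t * poly (pderiv (usp a n)) t - real n * (real n + real a) * poly (usp a n) t"
    for n t
  proof (cases "n + a = 0")
    case False
    then have "real n + real a \<noteq> 0" by linarith
    then show ?thesis
      unfolding poly_pderiv_usp_Suc_raw ode by (simp add: field_simps)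
  qed (simp add: usp_one pderiv_pCons)
  have ode: "(1 - t\<^sup>2) * poly (pderiv (pderiv (usp a n))) t =
      (real a + 1) * t * poly (pderiv (usp a n)) t - real n * (real n + real a) * poly (usp a n) t"
    for n t
  proof (induction n arbitrary: t)
    case (Suc n)
    show ?case
    proof (cases "n + a = 0")
      case True
      then show ?thesis by (simp add: usp_one pderiv_pCons)
    next
      case False
      then have nz: "real n + real a \<noteq> 0" by linarith
      define q where "q = smult (real n + 1)
          (usp a n + smult (1 / (real n + real a)) ([:0, 1:] * pderiv (usp a n)))"
      have "pderiv (usp a (Suc n)) = q"
        by (rule poly_ext) (subst step[OF Suc.IH], simp_all add: q_def algebra_simps)
      then have d2: "poly (pderiv (pderiv (usp a (Suc n)))) t = (real n + 1) *
          (poly (pderiv (usp a n)) t + (poly (pderiv (usp a n)) t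
             + t * poly (pderiv (pderiv (usp a n))) t) / (real n + real a))"
        by (simp add: q_def pderiv_smult pderiv_add pderiv_mult pderiv_pCons add_divide_distrib)
      define A B C where "A = poly (usp a n) t" and "B = poly (pderiv (usp a n)) t"
        and "C = poly (pderiv (pderiv (usp a n))) t"
      have e: "(1 - t\<^sup>2) * C = (real a + 1) * t * B - real n * (real n + real a) * A"
        using Suc.IH[of t] by (simp add: A_def B_def C_def)
      have "(1 - t\<^sup>2) * poly (pderiv (pderiv (usp a (Suc n)))) t =
          (real n + 1) * ((1 - t\<^sup>2) * B + ((1 - t\<^sup>2) * B + t * ((1 - t\<^sup>2) * C)) / (real n + real a))"
        unfolding d2 A_def[symmetric] B_def[symmetric] C_def[symmetric]
        by (simp add: algebra_simps add_divide_distrib diff_divide_distrib)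
      also have "\<dots> = (real a + 1) * t * ((real n + 1) * (A + t * B / (real n + real a)))
          - real (Suc n) * (real (Suc n) + real a) * (t * A - (1 - t\<^sup>2) * B / (real n + real a))"
      proof -
        define k b where "k = real n + real a" and "b = B / k"
        have B: "B = k * b" and k: "k \<noteq> 0" and a: "real a = k - real n"
          using nz by (auto simp: b_def k_def)
        have frac: "((1 - t\<^sup>2) * (k * b) + t * ((k - real n + 1) * t * (k * b) - real n * k * A)) / k
            = (1 - t\<^sup>2) * b + t * ((k - real n + 1) * t * b - real n * A)"
          using k by (simp add: field_simps)
        have frac': "(1 - t\<^sup>2) * (k * b) / k = (1 - t\<^sup>2) * b" "t * (k * b) / k = t * b"
          using k by simp_all
        show ?thesis
          unfolding e k_def[symmetric] unfolding B a unfolding frac frac'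
          by (simp add: algebra_simps power2_eq_square)
      qed
      finally show ?thesis
        unfolding poly_usp_Suc step[OF Suc.IH] A_def B_def .
    qed
  qed simp
  show "(1 - t\<^sup>2) * poly (pderiv (pderiv (usp a n))) t =
      (real a + 1) * t * poly (pderiv (usp a n)) t - real n * (real n + real a) * poly (usp a n) t"
    by (rule ode)
  show "poly (pderiv (usp a (Suc n))) t =
      (real n + 1) * (poly (usp a n) t + t * poly (pderiv (usp a n)) t / (real n + real a))"
    by (rule step[OF ode])
qed

lemma usp_lowering:
  "(1 - t\<^sup>2) * poly (pderiv (usp a (Suc n))) t
     = (real n + 1) * (poly (usp a n) t - t * poly (usp a (Suc n)) t)"
  unfolding poly_pderiv_usp_Suc poly_usp_Suc
  by (simp add: algebra_simps power2_eq_square add_divide_distrib diff_divide_distrib)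

lemma usp_three_term:
  "(2 * real n + 2 + real a) * (t * poly (usp a (Suc n)) t)
     = (real n + 1 + real a) * poly (usp a (Suc (Suc n))) t + (real n + 1) * poly (usp a n) t"
proof -
  have nz: "real n + 1 + real a \<noteq> 0" by linarith
  have "(real n + 1 + real a) * poly (usp a (Suc (Suc n))) t =
     (real n + 1 + real a) * (t * poly (usp a (Suc n)) t)
     - (1 - t\<^sup>2) * poly (pderiv (usp a (Suc n))) t"
    unfolding poly_usp_Suc[of a "Suc n"] using nz
    by (simp add: right_diff_distrib add.commute)
  then show ?thesis unfolding usp_lowering by (simp add: algebra_simps)
qed

text \<open>
  Differentiation raises the dimension of the sphere by two: both sides satisfy the recursion
  with parameter \<open>a + 2\<close>.
\<close>

lemma pderiv_usp:
  "pderiv (usp a (Suc n)) = smult (real (Suc n) * real (Suc n + a) / real (a + 1)) (usp (a + 2) n)"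
proof (induction n)
  case 0
  show ?case by (simp add: usp_one pderiv_pCons one_pCons)
next
  case (Suc n)
  have "poly (pderiv (usp a (Suc (Suc n)))) t
      = poly (smult (real (Suc (Suc n)) * real (Suc (Suc n) + a) / real (a + 1))
          (usp (a + 2) (Suc n))) t" for t
  proof -
    define Q Q' Q'' where "Q = poly (usp a (Suc n)) t" and "Q' = poly (pderiv (usp a (Suc n))) t"
      and "Q'' = poly (pderiv (pderiv (usp a (Suc n)))) t"
    define N where "N = real n + 1"
    define R R' where "R = poly (usp (a + 2) n) t" and "R' = poly (pderiv (usp (a + 2) n)) t"
    have pos: "N > 0" "N + real a > 0" "real a + 1 > 0" by (auto simp: N_def)
    have Q': "Q' = N * (N + real a) / (real a + 1) * R"
      by (simp add: Q'_def Suc R_def N_def add_ac)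
    have Q'': "Q'' = N * (N + real a) / (real a + 1) * R'"
      by (simp add: Q''_def Suc R'_def N_def pderiv_smult add_ac)
    have ode: "(1 - t\<^sup>2) * Q'' = (real a + 1) * t * Q' - N * (N + real a) * Q"
      using usp_ode[of t a "Suc n"] by (simp add: Q_def Q'_def Q''_def N_def add_ac)
    have Qe: "Q = (real a + 1) * t * Q' / (N * (N + real a)) - (1 - t\<^sup>2) * Q'' / (N * (N + real a))"
    proof -
      have "N * (N + real a) \<noteq> 0" using pos by simp
      then show ?thesis unfolding ode diff_divide_distrib by simp
    qed
    have "poly (pderiv (usp a (Suc (Suc n)))) t = (N + 1) * (Q + t * Q' / (N + real a))"
      unfolding poly_pderiv_usp_Suc[of a "Suc n"] by (simp add: Q_def Q'_def N_def add_ac)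
    also have "\<dots> = (N + 1) * (N + 1 + real a) / (real a + 1)
        * (t * R - (1 - t\<^sup>2) * R' / (N + real a + 1))"
    proof -
      have "Q = t * R - (1 - t\<^sup>2) * R' / (real a + 1)"
      proof -
        define b c where "b = real a + 1" and "c = N * (N + real a)"
        have "b \<noteq> 0" "c \<noteq> 0" using pos by (auto simp: b_def c_def)
        then show ?thesis
          unfolding Qe unfolding Q' Q'' b_def[symmetric] c_def[symmetric] by simp
      qed
      then have "Q + t * Q' / (N + real a) = t * R - (1 - t\<^sup>2) * R' / (real a + 1) + t * N / (real a + 1) * R"
        unfolding Q' using pos by simp
      also have "\<dots> = (N + 1 + real a) / (real a + 1) * (t * R - (1 - t\<^sup>2) * R' / (N + real a + 1))"
        using pos by (simp add: divide_simps) (simp add: algebra_simps)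
      finally show ?thesis by simp
    qed
    finally show ?thesis
      by (simp only: poly_smult poly_usp_Suc R_def R'_def N_def)
         (simp add: add_ac)
  qed
  then show ?case by (intro poly_ext) simp
qed

section \<open>Positive definiteness of ultraspherical polynomials\<close>

lemma has_derivative_real_polynomial_function:
  fixes u :: "'e::euclidean_space \<Rightarrow> real"
  assumes "real_polynomial_function u"
  shows "\<exists>u'. (\<forall>x. (u has_derivative u' x) (at x)) \<and> (\<forall>v. real_polynomial_function (\<lambda>x. u' x v))"
  using assms
proof induction
  case (linear f)
  then show ?case
    by (intro exI[of _ "\<lambda>x. f"]) (auto intro: bounded_linear_imp_has_derivative
        real_polynomial_function.intros)
next
  case (const c)
  show ?case
    by (intro exI[of _ "\<lambda>x v. 0"]) (auto intro: real_polynomial_function.intros)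
next
  case (add f g)
  then obtain f' g' where "\<forall>x. (f has_derivative f' x) (at x)" "\<forall>v. real_polynomial_function (\<lambda>x. f' x v)"
    "\<forall>x. (g has_derivative g' x) (at x)" "\<forall>v. real_polynomial_function (\<lambda>x. g' x v)" by blast
  then show ?case
    by (intro exI[of _ "\<lambda>x v. f' x v + g' x v"]) (auto intro!: has_derivative_add
        real_polynomial_function.intros(3))
next
  case (mult f g)
  then obtain f' g' where "\<forall>x. (f has_derivative f' x) (at x)" "\<forall>v. real_polynomial_function (\<lambda>x. f' x v)"
    "\<forall>x. (g has_derivative g' x) (at x)" "\<forall>v. real_polynomial_function (\<lambda>x. g' x v)" by blast
  with mult.hyps show ?case
    by (intro exI[of _ "\<lambda>x v. f x * g' x v + f' x v * g x"]) (auto intro!: has_derivative_mult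
        real_polynomial_function.intros(3,4))
qed

text \<open>
  For a unit vector \<open>x\<close>, the orthogonal projection of \<open>b\<close> to the tangent space of the unit sphere
  at \<open>x\<close>.
\<close>

definition tangent_part :: "'e::real_inner \<Rightarrow> 'e \<Rightarrow> 'e" where
  "tangent_part b x = b - (x \<bullet> b) *\<^sub>R x"

text \<open>
  The derivative of \<open>u\<close> at \<open>x\<close> along the tangential field \<open>tangent_part b\<close>. The formula makes
  sense for all \<open>x\<close> and maps polynomial functions to polynomial functions; at points of the unit
  sphere and for differentiable \<open>u\<close>, its value depends only on the restriction of \<open>u\<close> to the
  sphere.
\<close>

definition tderiv :: "'e::euclidean_space \<Rightarrow> ('e \<Rightarrow> real) \<Rightarrow> 'e \<Rightarrow> real" where
  "tderiv b u x = frechet_derivative u (at x) (tangent_part b x)"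

lemma real_polynomial_function_inner [intro]:
  "real_polynomial_function (\<lambda>x. x \<bullet> b)"
  by (intro real_polynomial_function.intros(1) bounded_linear_inner_left)

lemma real_polynomial_function_tderiv:
  assumes "real_polynomial_function (u :: 'e::euclidean_space \<Rightarrow> real)"
  shows "real_polynomial_function (tderiv b u)"
proof -
  obtain u' where u': "\<And>x. (u has_derivative u' x) (at x)"
    and poly: "\<And>v. real_polynomial_function (\<lambda>x. u' x v)"
    using has_derivative_real_polynomial_function[OF assms] by blast
  have "tderiv b u x = u' x b - (x \<bullet> b) * (\<Sum>e\<in>Basis. (x \<bullet> e) * u' x e)" for x
  proof -
    have lin: "linear (u' x)" using u' has_derivative_linear by blast
    have "tderiv b u x = u' x b - (x \<bullet> b) * u' x x"
      unfolding tderiv_def tangent_part_def frechet_derivative_at[OF u', symmetric]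
      by (simp add: linear_diff[OF lin] linear_cmul[OF lin])
    also have "u' x x = u' x (\<Sum>e\<in>Basis. (x \<bullet> e) *\<^sub>R e)" by (simp add: euclidean_representation)
    also have "\<dots> = (\<Sum>e\<in>Basis. (x \<bullet> e) * u' x e)"
      by (simp add: linear_sum[OF lin] linear_cmul[OF lin])
    finally show ?thesis .
  qed
  then have "tderiv b u = (\<lambda>x. u' x b - (x \<bullet> b) * (\<Sum>e\<in>Basis. (x \<bullet> e) * u' x e))" by blast
  then show ?thesis
    by (auto intro!: poly real_polynomial_function_diff real_polynomial_function_sum
        real_polynomial_function.intros(4))
qed

text \<open>
  For a unit vector \<open>x\<close> and \<open>v \<noteq> 0\<close> orthogonal to \<open>x\<close>, the great circle through \<open>x\<close> with
  velocity \<open>v\<close>; the vector \<open>v\<close> need not have norm \<open>1\<close>.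
\<close>

definition great_circle :: "'e::real_inner \<Rightarrow> 'e \<Rightarrow> real \<Rightarrow> 'e" where
  "great_circle x v s = cos (norm v * s) *\<^sub>R x + (sin (norm v * s) / norm v) *\<^sub>R v"

lemma great_circle_0 [simp]: "great_circle x v 0 = x"
  by (simp add: great_circle_def)

lemma great_circle_in_sphere:
  assumes "norm x = 1" "x \<bullet> v = 0" "v \<noteq> 0"
  shows "great_circle x v s \<in> sphere 0 1"
proof -
  have "(norm (great_circle x v s))\<^sup>2 = (cos (norm v * s))\<^sup>2 + (sin (norm v * s))\<^sup>2"
    unfolding great_circle_def power2_norm_eq_inner using assms
    by (simp add: inner_add_left inner_add_right inner_commute)
       (simp add: dot_square_norm power2_eq_square)
  then show ?thesis by simp (smt (verit) norm_ge_zero power2_eq_1_iff)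
qed

lemma has_derivative_great_circle_0:
  assumes "v \<noteq> 0"
  shows "(great_circle x v has_derivative (\<lambda>h. h *\<^sub>R v)) (at 0)"
proof -
  have "(great_circle x v has_vector_derivative v) (at 0)"
    unfolding great_circle_def has_vector_derivative_def
    by (rule derivative_eq_intros refl | use assms in \<open>simp add: fun_eq_iff\<close>)+
  then show ?thesis by (simp add: has_vector_derivative_def)
qed

lemma tangential_derivative_unique:
  fixes f g :: "'e::real_inner \<Rightarrow> real"
  assumes f: "(f has_derivative f') (at x)" and g: "(g has_derivative g') (at x)"
    and eq: "\<And>y. y \<in> sphere 0 1 \<Longrightarrow> f y = g y"
    and x: "norm x = 1" and v: "x \<bullet> v = 0"
  shows "f' v = g' v"
proof (cases "v = 0")
  case True
  then show ?thesis
    using f g by (simp add: has_derivative_bounded_linear linear_0 bounded_linear.linear)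
next
  case False
  have "((f \<circ> great_circle x v) has_derivative (f' \<circ> (\<lambda>h. h *\<^sub>R v))) (at 0)"
    by (rule diff_chain_at) (use has_derivative_great_circle_0[OF False] f in auto)
  moreover have "((g \<circ> great_circle x v) has_derivative (g' \<circ> (\<lambda>h. h *\<^sub>R v))) (at 0)"
    by (rule diff_chain_at) (use has_derivative_great_circle_0[OF False] g in auto)
  moreover have "f \<circ> great_circle x v = g \<circ> great_circle x v"
    using great_circle_in_sphere[OF x v False] eq by (auto simp: fun_eq_iff)
  ultimately have "f' \<circ> (\<lambda>h. h *\<^sub>R v) = g' \<circ> (\<lambda>h. h *\<^sub>R v)"
    using has_derivative_unique by metis
  then show ?thesis by (metis comp_apply scaleR_one)
qed

lemma inner_tangent_part: "norm x = 1 \<Longrightarrow> x \<bullet> tangent_part b x = 0"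
  by (simp add: tangent_part_def inner_diff_right dot_square_norm)

text \<open>
  \<open>K\<close> is, on the unit sphere, the Gram kernel of a finite family of polynomial functions. Such
  kernels are positive definite, and they allow differentiation of the members of the family.
\<close>

definition polynomial_gram :: "('e::euclidean_space \<Rightarrow> 'e \<Rightarrow> real) \<Rightarrow> bool" where
  "polynomial_gram K \<longleftrightarrow> (\<exists>us. (\<forall>u\<in>set us. real_polynomial_function u) \<and>
     (\<forall>x\<in>sphere 0 1. \<forall>y\<in>sphere 0 1. K x y = (\<Sum>u\<leftarrow>us. u x * u y)))"

lemma polynomial_gram_sum:
  assumes "finite B" "\<And>b. b \<in> B \<Longrightarrow> polynomial_gram (K b)"
  shows "polynomial_gram (\<lambda>x y. \<Sum>b\<in>B. K b x y)"
  using assms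
proof (induction B)
  case empty
  show ?case unfolding polynomial_gram_def by (intro exI[of _ "[]"]) auto
next
  case (insert b B)
  obtain us where us: "\<forall>u\<in>set us. real_polynomial_function u"
    "\<forall>x\<in>sphere 0 1. \<forall>y\<in>sphere 0 1. K b x y = (\<Sum>u\<leftarrow>us. u x * u y)"
    using insert.prems[of b] by (auto simp: polynomial_gram_def)
  obtain vs where vs: "\<forall>u\<in>set vs. real_polynomial_function u"
    "\<forall>x\<in>sphere 0 1. \<forall>y\<in>sphere 0 1. (\<Sum>b\<in>B. K b x y) = (\<Sum>u\<leftarrow>vs. u x * u y)"
    using insert by (auto simp: polynomial_gram_def)
  show ?case unfolding polynomial_gram_def using us vs insert.hyps
    by (intro exI[of _ "us @ vs"]) auto
qed

lemma polynomial_gram_scale: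
  assumes "polynomial_gram K" "0 \<le> c"
  shows "polynomial_gram (\<lambda>x y. c * K x y)"
proof -
  obtain us where us: "\<forall>u\<in>set us. real_polynomial_function u"
    "\<forall>x\<in>sphere 0 1. \<forall>y\<in>sphere 0 1. K x y = (\<Sum>u\<leftarrow>us. u x * u y)"
    using assms by (auto simp: polynomial_gram_def)
  have "c * (\<Sum>u\<leftarrow>us. u x * u y) = (\<Sum>u\<leftarrow>map (\<lambda>u x. sqrt c * u x) us. u x * u y)" for x y
    using \<open>0 \<le> c\<close> by (induction us) (auto simp: algebra_simps)
  then show ?thesis unfolding polynomial_gram_def using us
    by (intro exI[of _ "map (\<lambda>u x. sqrt c * u x) us"])
       (auto intro: real_polynomial_function.intros)
qed

lemma sum_inner_Basis:
  fixes x y :: "'e::euclidean_space"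
  shows "(\<Sum>b\<in>Basis. (x \<bullet> b) * (y \<bullet> b)) = x \<bullet> y"
  by (simp add: euclidean_inner[of x y])

lemma has_derivative_poly_inner:
  fixes z :: "'e::real_inner"
  shows "((\<lambda>x. poly p (z \<bullet> x)) has_derivative (\<lambda>v. poly (pderiv p) (z \<bullet> x) * (z \<bullet> v))) (at x)"
proof -
  have "(poly p has_derivative (\<lambda>h. poly (pderiv p) (z \<bullet> x) * h)) (at (z \<bullet> x))"
    using poly_DERIV[of p "z \<bullet> x"] by (simp add: has_field_derivative_def)
  moreover have "((\<lambda>x. z \<bullet> x) has_derivative (\<lambda>v. z \<bullet> v)) (at x)"
    by (rule derivative_eq_intros refl | simp)+
  ultimately show ?thesis
    using diff_chain_at[of "\<lambda>x. z \<bullet> x" "\<lambda>v. z \<bullet> v" x "poly p"] by (simp add: o_def)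
qed

text \<open>
  If \<open>P\<^sub>n (x \<bullet> y) = \<Sum>u. u x * u y\<close> on the sphere, apply to each \<open>u\<close> the raising operators
  \<open>R b u x = (n + a) (x \<bullet> b) u x - tderiv b u x\<close> for \<open>b\<close> in the basis (they take the restriction of a
  solid harmonic of degree \<open>n\<close> to one of degree \<open>n + 1\<close>). Applying them in both variables and
  summing over \<open>b\<close> gives \<open>P\<^sub>n\<^sub>+\<^sub>1 (x \<bullet> y)\<close> up to a positive factor: the sum is an expression in
  \<open>t = x \<bullet> y\<close> and the first two derivatives of \<open>P\<^sub>n\<close>, which the differential equation reduces to
  the recursion for \<open>P\<^sub>n\<^sub>+\<^sub>1\<close>. For \<open>n = a = 0\<close> that factor vanishes, hence \<open>n > 0\<close>.
\<close>

lemma polynomial_gram_usp_step: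
  assumes dim: "DIM('e::euclidean_space) = a + 2" and n: "n > 0"
    and gram: "polynomial_gram (\<lambda>x y :: 'e. poly (usp a n) (x \<bullet> y))"
  shows "polynomial_gram (\<lambda>x y :: 'e. poly (usp a (Suc n)) (x \<bullet> y))"
proof -
  let ?P = "poly (usp a n)" and ?P' = "poly (pderiv (usp a n))"
    and ?P'' = "poly (pderiv (pderiv (usp a n)))"
  obtain us where us': "\<forall>u\<in>set us. real_polynomial_function u"
    and eq': "\<forall>x\<in>sphere 0 1. \<forall>y\<in>sphere (0::'e) 1. ?P (x \<bullet> y) = (\<Sum>u\<leftarrow>us. u x * u y)"
    using gram unfolding polynomial_gram_def by blast
  note us = us'[rule_format] and eq = eq'[rule_format]
  define k where "k = real n + real a"
  define R where "R b u x = k * (x \<bullet> b) * u x - tderiv b u x" for b u and x :: 'e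
  have der: "(u has_derivative frechet_derivative u (at x)) (at x)" if "u \<in> set us" for u x
    using differentiable_at_real_polynomial_function[OF us[OF that]] frechet_derivative_works by blast
  have sumder: "((\<lambda>x. \<Sum>u\<leftarrow>vs. f u x * c u) has_derivative (\<lambda>v. \<Sum>u\<leftarrow>vs. f' u v * c u)) (at x)"
    if "\<And>u. u \<in> set vs \<Longrightarrow> (f u has_derivative f' u) (at x)"
    for vs :: "('e \<Rightarrow> real) list" and f :: "('e \<Rightarrow> real) \<Rightarrow> 'e \<Rightarrow> real" and c f' x
    using that
  proof (induction vs)
    case (Cons u vs)
    then show ?case by (auto intro!: has_derivative_add has_derivative_mult_left)
  qed auto
  \<comment> \<open>The tangential derivative of \<open>\<Sum>u. u x * u y = P\<^sub>n (x \<bullet> y)\<close> in \<open>x\<close>, then in \<open>y\<close> as well.\<close>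
  have D1: "(\<Sum>u\<leftarrow>us. tderiv b u x * u y) = ?P' (x \<bullet> y) * ((y \<bullet> b) - (x \<bullet> b) * (x \<bullet> y))"
    if x: "x \<in> sphere 0 1" and y: "y \<in> sphere 0 1" for x y b :: 'e
  proof -
    have "(\<Sum>u\<leftarrow>us. frechet_derivative u (at x) (tangent_part b x) * u y)
        = ?P' (y \<bullet> x) * (y \<bullet> tangent_part b x)"
    proof (rule tangential_derivative_unique[OF _ has_derivative_poly_inner])
      show "((\<lambda>x. \<Sum>u\<leftarrow>us. u x * u y) has_derivative
          (\<lambda>v. \<Sum>u\<leftarrow>us. frechet_derivative u (at x) v * u y)) (at x)"
        by (rule sumder) (rule der)
      show "(\<Sum>u\<leftarrow>us. u z * u y) = poly (usp a n) (y \<bullet> z)" if "z \<in> sphere 0 1" for z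
        using eq[OF that y] by (simp add: inner_commute)
    qed (use x in \<open>auto simp: inner_tangent_part\<close>)
    then show ?thesis
      by (simp add: tderiv_def tangent_part_def inner_diff_right inner_commute)
  qed
  have D2: "(\<Sum>u\<leftarrow>us. tderiv b u x * tderiv b u y) =
      ?P'' (x \<bullet> y) * ((x \<bullet> b) - (y \<bullet> b) * (x \<bullet> y)) * ((y \<bullet> b) - (x \<bullet> b) * (x \<bullet> y))
      + ?P' (x \<bullet> y) * ((1 - (y \<bullet> b)\<^sup>2) - (x \<bullet> b) * ((x \<bullet> b) - (y \<bullet> b) * (x \<bullet> y)))"
    if x: "x \<in> sphere 0 1" and y: "y \<in> sphere 0 1" and b: "b \<in> Basis" for x y b :: 'e
  proof -
    have "((\<lambda>y. \<Sum>u\<leftarrow>us. u y * tderiv b u x) has_derivative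
        (\<lambda>v. \<Sum>u\<leftarrow>us. frechet_derivative u (at y) v * tderiv b u x)) (at y)"
      using sumder[of us "\<lambda>u. u" "\<lambda>u. frechet_derivative u (at y)" y "\<lambda>u. tderiv b u x"] der
      by blast
    moreover have "((\<lambda>y. ?P' (x \<bullet> y) * ((y \<bullet> b) - (x \<bullet> b) * (x \<bullet> y))) has_derivative
        (\<lambda>v. ?P' (x \<bullet> y) * ((v \<bullet> b) - (x \<bullet> b) * (x \<bullet> v))
          + (?P'' (x \<bullet> y) * (x \<bullet> v)) * ((y \<bullet> b) - (x \<bullet> b) * (x \<bullet> y)))) (at y)"
      by (rule has_derivative_mult has_derivative_poly_inner derivative_eq_intros refl | simp)+
    moreover have "(\<Sum>u\<leftarrow>us. u z * tderiv b u x) = ?P' (x \<bullet> z) * ((z \<bullet> b) - (x \<bullet> b) * (x \<bullet> z))"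
      if "z \<in> sphere 0 1" for z
      using D1[OF x that, of b] by (simp add: mult.commute)
    moreover have "norm y = 1" using y by simp
    ultimately have "(\<Sum>u\<leftarrow>us. frechet_derivative u (at y) (tangent_part b y) * tderiv b u x)
        = ?P' (x \<bullet> y) * ((tangent_part b y \<bullet> b) - (x \<bullet> b) * (x \<bullet> tangent_part b y))
          + (?P'' (x \<bullet> y) * (x \<bullet> tangent_part b y)) * ((y \<bullet> b) - (x \<bullet> b) * (x \<bullet> y))"
      by (rule tangential_derivative_unique) (use y in \<open>auto simp: inner_tangent_part\<close>)
    moreover have "tangent_part b y \<bullet> b = 1 - (y \<bullet> b)\<^sup>2"
      using b by (simp add: tangent_part_def inner_diff_left power2_eq_square)
    moreover have "x \<bullet> tangent_part b y = (x \<bullet> b) - (y \<bullet> b) * (x \<bullet> y)"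
      by (simp add: tangent_part_def inner_diff_right)
    ultimately show ?thesis by (simp add: tderiv_def mult_ac)
  qed
  have main: "(\<Sum>b\<in>Basis. \<Sum>u\<leftarrow>us. R b u x * R b u y) =
      (2 * real n + real a) * k * poly (usp a (Suc n)) (x \<bullet> y)"
    if x: "x \<in> sphere 0 1" and y: "y \<in> sphere 0 1" for x y :: 'e
  proof -
    define t where "t = x \<bullet> y"
    have split: "(\<Sum>u\<leftarrow>us. R b u x * R b u y) =
        k\<^sup>2 * (x \<bullet> b) * (y \<bullet> b) * (\<Sum>u\<leftarrow>us. u x * u y)
        - k * (x \<bullet> b) * (\<Sum>u\<leftarrow>us. tderiv b u y * u x) - k * (y \<bullet> b) * (\<Sum>u\<leftarrow>us. tderiv b u x * u y)
        + (\<Sum>u\<leftarrow>us. tderiv b u x * tderiv b u y)" for b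
      by (induction us) (auto simp: R_def algebra_simps power2_eq_square)
    define A B where "A = k\<^sup>2 * ?P t + (1 + t\<^sup>2) * ?P'' t + (2 * k + 1) * t * ?P' t"
      and "B = (k + 1) * ?P' t + t * ?P'' t"
    have "(\<Sum>u\<leftarrow>us. R b u x * R b u y) =
        A * ((x \<bullet> b) * (y \<bullet> b)) - B * ((x \<bullet> b) * (x \<bullet> b)) - B * ((y \<bullet> b) * (y \<bullet> b)) + ?P' t"
      if b: "b \<in> Basis" for b
      unfolding split D2[OF x y b] D1[OF x y] D1[OF y x] eq[OF x y, symmetric]
        inner_commute[of y x] t_def[symmetric] A_def B_def
      by (simp add: algebra_simps power2_eq_square)
    then have "(\<Sum>b\<in>Basis. \<Sum>u\<leftarrow>us. R b u x * R b u y) = A * t - B - B + (real a + 2) * ?P' t"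
      using x y dim by (simp add: sum.distrib sum_subtractf sum_distrib_left[symmetric]
          sum_inner_Basis t_def dot_square_norm)
    also have "\<dots> = k\<^sup>2 * t * ?P t - t * ((1 - t\<^sup>2) * ?P'' t)
        + (real a + t\<^sup>2 - 2 * k * (1 - t\<^sup>2)) * ?P' t"
      unfolding A_def B_def by (simp add: algebra_simps power2_eq_square)
    also have "\<dots> = (2 * real n + real a) * (k * t * ?P t - (1 - t\<^sup>2) * ?P' t)"
      unfolding usp_ode k_def by (simp add: algebra_simps power2_eq_square)
    also have "\<dots> = (2 * real n + real a) * k * poly (usp a (Suc n)) t"
      unfolding poly_usp_Suc k_def using n by (simp add: field_simps)
    finally show ?thesis unfolding t_def .
  qed
  have "real_polynomial_function (\<lambda>x. k * (x \<bullet> b) * u x - tderiv b u x)" if "u \<in> set us" for b u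
    using us[OF that] by (auto intro!: real_polynomial_function_diff real_polynomial_function_tderiv
        real_polynomial_function.intros(2,4))
  then have "\<forall>v\<in>set (map (R b) us). real_polynomial_function v" for b
    by (auto simp: R_def[abs_def])
  then have "polynomial_gram (\<lambda>x y. \<Sum>u\<leftarrow>us. R b u x * R b u y)" for b
    unfolding polynomial_gram_def by (intro exI[of _ "map (R b) us"]) (auto simp: o_def)
  then have "polynomial_gram (\<lambda>x y. 1 / ((2 * real n + real a) * k) * (\<Sum>b\<in>Basis. \<Sum>u\<leftarrow>us. R b u x * R b u y))"
    by (intro polynomial_gram_scale polynomial_gram_sum) (auto simp: k_def)
  moreover have "(2 * real n + real a) * k \<noteq> 0" using n by (simp add: k_def)
  ultimately show ?thesis using main by (simp add: polynomial_gram_def)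
qed

lemma polynomial_gram_usp:
  assumes dim: "DIM('e::euclidean_space) = a + 2"
  shows "polynomial_gram (\<lambda>x y :: 'e. poly (usp a n) (x \<bullet> y))"
proof (induction n)
  case 0
  show ?case unfolding polynomial_gram_def
    by (intro exI[of _ "[\<lambda>x. 1]"]) (auto intro: real_polynomial_function.intros)
next
  case (Suc n)
  show ?case
  proof (cases "n = 0")
    case True
    have "polynomial_gram (\<lambda>x y :: 'e. \<Sum>b\<in>Basis. (x \<bullet> b) * (y \<bullet> b))"
      by (intro polynomial_gram_sum finite_Basis, unfold polynomial_gram_def)
         (rule_tac x = "[\<lambda>x. x \<bullet> b]" in exI, auto)
    then show ?thesis unfolding sum_inner_Basis by (simp add: True usp_one)
  qed (use polynomial_gram_usp_step[OF dim _ Suc] in simp)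
qed

text \<open>
  The Schur product of a positive semidefinite matrix \<open>M\<close> with the Gram matrix of an
  ultraspherical polynomial is again positive semidefinite.
\<close>

lemma usp_gram_nonneg:
  fixes p :: "nat \<Rightarrow> 'e::euclidean_space"
  assumes dim: "DIM('e) = a + 2" and p: "\<And>i. i < N \<Longrightarrow> p i \<in> sphere 0 1"
    and M: "\<And>b. 0 \<le> (\<Sum>i<N. \<Sum>j<N. b i * M i j * b j)"
  shows "0 \<le> (\<Sum>i<N. \<Sum>j<N. c i * (M i j * poly (usp a n) (p i \<bullet> p j)) * c j)"
proof -
  obtain us where eq: "\<forall>x\<in>sphere 0 1. \<forall>y\<in>sphere (0::'e) 1.
      poly (usp a n) (x \<bullet> y) = (\<Sum>u\<leftarrow>us. u x * u y)"
    using polynomial_gram_usp[OF dim, of n] unfolding polynomial_gram_def by blast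
  have "(\<Sum>i<N. \<Sum>j<N. c i * (M i j * poly (usp a n) (p i \<bullet> p j)) * c j)
      = (\<Sum>i<N. \<Sum>j<N. c i * (M i j * (\<Sum>u\<leftarrow>us. u (p i) * u (p j))) * c j)"
    by (intro sum.cong refl) (use eq p in auto)
  also have "\<dots> = (\<Sum>u\<leftarrow>us. \<Sum>i<N. \<Sum>j<N. (c i * u (p i)) * M i j * (c j * u (p j)))"
    by (induction us) (auto simp: algebra_simps sum.distrib)
  also have "\<dots> \<ge> 0"
    by (intro sum_list_nonneg) (use M in auto)
  finally show ?thesis .
qed

lemma exists_unit_vectors_inner:
  assumes "DIM('e::euclidean_space) \<ge> 2" "-1 \<le> s" "s \<le> 1"
  shows "\<exists>x\<in>sphere (0::'e) 1. \<exists>y\<in>sphere 0 1. x \<bullet> y = s"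
proof -
  obtain e f :: 'e where ef: "e \<in> Basis" "f \<in> Basis" "e \<noteq> f"
    using assms(1) card_le_Suc0_iff_eq[of "Basis :: 'e set"] by fastforce
  define y where "y = s *\<^sub>R e + sqrt (1 - s\<^sup>2) *\<^sub>R f"
  have "s\<^sup>2 \<le> 1" using assms by (simp add: abs_square_le_1 abs_le_iff)
  then have "y \<bullet> y = 1"
    using ef by (simp add: y_def inner_add_left inner_add_right inner_Basis flip: power2_eq_square)
  moreover have "e \<bullet> y = s" using ef by (simp add: y_def inner_add_right inner_Basis)
  ultimately show ?thesis using ef by (intro bexI[of _ e] bexI[of _ y]) (auto simp: norm_eq_1)
qed

text \<open>
  The kernel of \<open>P\<^sub>n\<close> is positive definite, and the diagonal value is \<open>P\<^sub>n 1 = 1\<close>: consider two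
  unit vectors with inner product \<open>s\<close>.
\<close>

lemma abs_poly_usp_le_1:
  assumes dim: "DIM('e::euclidean_space) = a + 2" and s: "-1 \<le> s" "s \<le> 1"
  shows "\<bar>poly (usp a n) s\<bar> \<le> 1"
proof -
  obtain x y :: 'e where xy: "x \<in> sphere 0 1" "y \<in> sphere 0 1" "x \<bullet> y = s"
    using exists_unit_vectors_inner[where 'e = 'e, OF _ s] dim by auto
  define p where "p i = (if i = 0 then x else y)" for i :: nat
  have "0 \<le> (\<Sum>i<2. \<Sum>j<2. c i * (1 * poly (usp a n) (p i \<bullet> p j)) * c j)" for c :: "nat \<Rightarrow> real"
  proof (rule usp_gram_nonneg[OF dim])
    show "0 \<le> (\<Sum>i<2. \<Sum>j<2. b i * 1 * b j)" for b :: "nat \<Rightarrow> real"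
      using zero_le_power2[of "b 0 + b 1"]
      by (simp add: numeral_2_eq_2 power2_eq_square algebra_simps)
  qed (use xy in \<open>auto simp: p_def\<close>)
  from this[of "\<lambda>i. 1"] this[of "\<lambda>i. if i = 0 then 1 else -1"] show ?thesis
    using xy by (simp add: numeral_2_eq_2 p_def inner_commute norm_eq_1)
qed

section \<open>Integration against the ultraspherical weight\<close>

text \<open>
  The integral of \<open>f\<close> over \<open>[-1, 1]\<close> with the ultraspherical weight \<open>(1 - s\<^sup>2)\<^bsup>(a - 1)/2\<^esup>\<close>, after
  the substitution \<open>s = cos \<theta>\<close>. The substitution removes the singularity of the weight at the end
  points for \<open>a = 0\<close>.
\<close>

definition usp_int :: "nat \<Rightarrow> (real \<Rightarrow> real) \<Rightarrow> real" where
  "usp_int a f = integral {0..pi} (\<lambda>\<theta>. f (cos \<theta>) * sin \<theta> ^ a)"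

lemma continuous_on_usp_integrand:
  assumes "continuous_on {-1..1} f"
  shows "continuous_on {0..pi} (\<lambda>\<theta>. f (cos \<theta>) * sin \<theta> ^ a :: real)"
  by (intro continuous_intros continuous_on_compose2[OF assms]) auto

lemmas integrable_usp = integrable_continuous_real[OF continuous_on_usp_integrand]

lemma usp_int_cong:
  "(\<And>x. x \<in> {-1..1} \<Longrightarrow> f x = g x) \<Longrightarrow> usp_int a f = usp_int a g"
  unfolding usp_int_def by (intro Henstock_Kurzweil_Integration.integral_cong) auto

lemma usp_int_add:
  assumes "continuous_on {-1..1} f" "continuous_on {-1..1} g"
  shows "usp_int a (\<lambda>x. f x + g x) = usp_int a f + usp_int a g"
  unfolding usp_int_def using integrable_usp[OF assms(1)] integrable_usp[OF assms(2)]
  by (simp add: distrib_right Henstock_Kurzweil_Integration.integral_add)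

lemma usp_int_cmult: "usp_int a (\<lambda>x. c * f x) = c * usp_int a f"
  unfolding usp_int_def by (simp add: mult.assoc)

lemma usp_int_minus: "usp_int a (\<lambda>x. - f x) = - usp_int a f"
  using usp_int_cmult[of a "-1" f] by simp

lemma usp_int_diff:
  assumes "continuous_on {-1..1} f" "continuous_on {-1..1} g"
  shows "usp_int a (\<lambda>x. f x - g x) = usp_int a f - usp_int a g"
  using usp_int_add[OF assms(1) continuous_on_minus[OF assms(2)], of a] usp_int_minus[of a g] by simp

lemma usp_int_sum:
  assumes "\<And>i. i \<in> I \<Longrightarrow> continuous_on {-1..1} (f i)"
  shows "usp_int a (\<lambda>x. \<Sum>i\<in>I. f i x) = (\<Sum>i\<in>I. usp_int a (f i))"
proof (cases "finite I")
  case True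
  then show ?thesis unfolding usp_int_def sum_distrib_right
    by (intro Henstock_Kurzweil_Integration.integral_sum integrable_usp assms) auto
qed (simp add: usp_int_def)

lemma usp_int_mono:
  assumes "continuous_on {-1..1} f" "continuous_on {-1..1} g"
    and "\<And>x. x \<in> {-1..1} \<Longrightarrow> f x \<le> g x"
  shows "usp_int a f \<le> usp_int a g"
  unfolding usp_int_def
  by (intro integral_le integrable_usp assms mult_right_mono) (auto simp: sin_ge_zero)

lemma usp_int_eq_0_imp:
  assumes cont: "continuous_on {-1..1} u" and nonneg: "\<And>x. x \<in> {-1..1} \<Longrightarrow> 0 \<le> u x"
    and 0: "usp_int a u = 0" and x: "x \<in> {-1..1}"
  shows "u x = 0"
proof -
  have "\<forall>\<theta>\<in>{0..pi}. u (cos \<theta>) * sin \<theta> ^ a = 0"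
    using 0 integral_eq_0_iff[OF continuous_on_usp_integrand[OF cont, of a]] nonneg
    by (auto simp: usp_int_def sin_ge_zero)
  then have *: "u (cos \<theta>) = 0" if "0 < \<theta>" "\<theta> < pi" for \<theta>
    using sin_gt_zero[OF that] that by fastforce
  have "u y = 0" if "y \<in> {-1<..<1}" for y
    using that *[of "arccos y"] arccos_lt_bounded[of y] by auto
  moreover have "closure {-1<..<1} = {-1..1::real}" by simp
  ultimately show ?thesis
    using continuous_constant_on_closure[of "{-1<..<1}" u 0 x] cont x by auto
qed

lemma usp_int_pos:
  assumes cont: "continuous_on {-1..1} u" and nonneg: "\<And>x. x \<in> {-1..1} \<Longrightarrow> 0 \<le> u x"
    and x: "x \<in> {-1..1}" "u x \<noteq> 0"
  shows "0 < usp_int a u"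
  using usp_int_eq_0_imp[OF cont nonneg, of a x] usp_int_mono[OF _ cont, of "\<lambda>_. 0" a] nonneg x
  by (force simp: usp_int_def)

text \<open>
  The integrand is the derivative of \<open>(1 - s\<^sup>2)\<^bsup>(a + 1)/2\<^esup> r(s)\<close>, divided by the weight, and
  this function vanishes at both end points.
\<close>

lemma usp_int_divergence:
  "usp_int a (\<lambda>s. (1 - s\<^sup>2) * poly (pderiv r) s - (real a + 1) * s * poly r s) = 0"
proof -
  have "((\<lambda>\<theta>. - (sin \<theta> ^ (a + 1) * poly r (cos \<theta>))) has_vector_derivative
      ((1 - (cos \<theta>)\<^sup>2) * poly (pderiv r) (cos \<theta>) - (real a + 1) * cos \<theta> * poly r (cos \<theta>)) * sin \<theta> ^ a)
      (at \<theta> within {0..pi})" for \<theta>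
  proof -
    have "((\<lambda>\<theta>. - (sin \<theta> ^ (a + 1) * poly r (cos \<theta>))) has_real_derivative
      ((1 - (cos \<theta>)\<^sup>2) * poly (pderiv r) (cos \<theta>) - (real a + 1) * cos \<theta> * poly r (cos \<theta>)) * sin \<theta> ^ a)
      (at \<theta>)"
      unfolding sin_squared_eq[symmetric]
      by (rule derivative_eq_intros poly_DERIV[THEN DERIV_chain2] refl)+
         (simp add: algebra_simps power2_eq_square)
    then show ?thesis
      by (simp add: has_real_derivative_iff_has_vector_derivative has_vector_derivative_at_within)
  qed
  then show ?thesis
    using fundamental_theorem_of_calculus[of 0 pi "\<lambda>\<theta>. - (sin \<theta> ^ (a + 1) * poly r (cos \<theta>))"]
    unfolding usp_int_def by (metis (no_types, lifting) add_gr_0 diff_self integral_unique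
        less_numeral_extra(1) minus_zero mult_zero_left pi_ge_zero power_eq_0_iff sin_pi sin_zero)
qed

text \<open>
  The action of the Laplace-Beltrami operator of the sphere \<open>S\<^sup>a\<^sup>+\<^sup>1\<close> on zonal functions
  \<open>x \<mapsto> q (z \<bullet> x)\<close>, as an operator on polynomials \<open>q\<close>.
\<close>

definition usp_lap :: "nat \<Rightarrow> real poly \<Rightarrow> real poly" where
  "usp_lap a q = [:1, 0, -1:] * pderiv (pderiv q) - smult (real a + 1) ([:0, 1:] * pderiv q)"

lemma poly_usp_lap:
  "poly (usp_lap a q) s = (1 - s\<^sup>2) * poly (pderiv (pderiv q)) s - (real a + 1) * s * poly (pderiv q) s"
  by (simp add: usp_lap_def power2_eq_square algebra_simps)

lemma usp_lap_usp: "poly (usp_lap a (usp a n)) s = - (real n * (real n + real a)) * poly (usp a n) s"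
  unfolding poly_usp_lap usp_ode by simp

lemma usp_lap_add: "usp_lap a (p + q) = usp_lap a p + usp_lap a q"
  by (simp add: usp_lap_def pderiv_add algebra_simps smult_add_right)

lemma usp_lap_smult: "usp_lap a (smult c p) = smult c (usp_lap a p)"
  by (rule poly_ext) (simp add: poly_usp_lap pderiv_smult algebra_simps)

lemma usp_int_lap: "usp_int a (poly (usp_lap a q)) = 0"
  using usp_int_divergence[of a "pderiv q"] by (simp add: poly_usp_lap[abs_def])

lemma usp_orthogonal:
  assumes "n \<noteq> k"
  shows "usp_int a (\<lambda>s. poly (usp a n) s * poly (usp a k) s) = 0"
proof -
  let ?P = "usp a n" and ?Q = "usp a k"
  define e where "e = real k * (real k + real a) - real n * (real n + real a)"
  have "usp_int a (\<lambda>s. e * (poly ?P s * poly ?Q s)) = 0"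
  proof -
    have "e * (poly ?P s * poly ?Q s) = (1 - s\<^sup>2) * poly (pderiv (?Q * pderiv ?P - ?P * pderiv ?Q)) s
         - (real a + 1) * s * poly (?Q * pderiv ?P - ?P * pderiv ?Q) s" for s
    proof -
      have "e * (poly ?P s * poly ?Q s)
          = poly (usp_lap a ?P) s * poly ?Q s - poly (usp_lap a ?Q) s * poly ?P s"
        unfolding usp_lap_usp e_def by (simp add: algebra_simps)
      then show ?thesis unfolding poly_usp_lap
        by (simp add: pderiv_diff pderiv_mult algebra_simps)
    qed
    then show ?thesis by (simp only: usp_int_divergence)
  qed
  moreover have "e = (real k - real n) * (real k + real n + real a)"
    by (simp add: e_def algebra_simps)
  then have "e \<noteq> 0" using assms by auto
  ultimately show ?thesis by (simp add: usp_int_cmult)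
qed

lemma usp_norm_pos: "0 < usp_int a (\<lambda>s. poly (usp a n) s * poly (usp a n) s)"
  by (rule usp_int_pos[where x = 1]) (auto intro!: continuous_intros)

text \<open>
  Up to positive factors, the integrals of \<open>u P\<^sub>k\<close> are the expansion coefficients of \<open>u\<close>. Their
  nonnegativity passes from \<open>u\<close> to \<open>x u\<close> because the three-term recurrence writes \<open>x P\<^sub>k\<close> as a
  nonnegative combination of \<open>P\<^sub>k\<^sub>+\<^sub>1\<close> and \<open>P\<^sub>k\<^sub>-\<^sub>1\<close>.
\<close>

lemma usp_coeffs_nonneg_mult_x:
  assumes cont: "continuous_on {-1..1} u"
    and pos: "\<And>k. 0 \<le> usp_int a (\<lambda>x. u x * poly (usp a k) x)"
  shows "0 \<le> usp_int a (\<lambda>x. x * u x * poly (usp a k) x)"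
proof (cases k)
  case 0
  then show ?thesis using pos[of 1] by (simp add: usp_one mult.commute)
next
  case (Suc n)
  have "(2 * real n + 2 + real a) * (x * u x * poly (usp a (Suc n)) x) =
      (real n + 1 + real a) * (u x * poly (usp a (Suc (Suc n))) x)
      + (real n + 1) * (u x * poly (usp a n) x)" for x
    using arg_cong[OF usp_three_term[of n a x], of "\<lambda>y. u x * y"] by (simp add: algebra_simps)
  then have "usp_int a (\<lambda>x. (2 * real n + 2 + real a) * (x * u x * poly (usp a (Suc n)) x)) =
      usp_int a (\<lambda>x. (real n + 1 + real a) * (u x * poly (usp a (Suc (Suc n))) x)
      + (real n + 1) * (u x * poly (usp a n) x))" by (simp only:)
  also have "\<dots> = (real n + 1 + real a) * usp_int a (\<lambda>x. u x * poly (usp a (Suc (Suc n))) x)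
      + (real n + 1) * usp_int a (\<lambda>x. u x * poly (usp a n) x)"
    by (subst usp_int_add) (auto intro!: continuous_intros cont simp: usp_int_cmult)
  also have "\<dots> \<ge> 0" using pos by simp
  finally show ?thesis
    unfolding usp_int_cmult by (auto simp: Suc zero_le_mult_iff)
qed

text \<open>
  The integral of \<open>u (1 + x)\<^sup>m\<close> is nonnegative for every \<open>m\<close>, and for large \<open>m\<close> the weight
  \<open>(1 + x)\<^sup>m\<close> concentrates at \<open>1\<close>. The concentration is quantified by comparing the integrals
  \<open>J\<close> of \<open>(1 - x) (1 + x)\<^sup>m\<close> and \<open>I\<close> of \<open>(1 + x)\<^sup>m\<close>: integration by parts gives
  \<open>m J \<le> (a + 1) I\<close>.
\<close>

lemma usp_coeffs_nonneg_at_1: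
  assumes cont: "continuous_on {-1..1} u"
    and pos: "\<And>k. 0 \<le> usp_int a (\<lambda>x. u x * poly (usp a k) x)"
  shows "0 \<le> u 1"
proof (rule ccontr)
  assume "\<not> 0 \<le> u 1"
  define \<delta> where "\<delta> = - u 1 / 2"
  have \<delta>: "\<delta> > 0" using \<open>\<not> 0 \<le> u 1\<close> by (simp add: \<delta>_def)
  obtain \<eta> where \<eta>: "\<eta> > 0" and near: "\<And>x. x \<in> {-1..1} \<Longrightarrow> \<bar>x - 1\<bar> < \<eta> \<Longrightarrow> \<bar>u x - u 1\<bar> < \<delta>"
  proof -
    have "1 \<in> {-1..1::real}" by simp
    then show ?thesis
      using cont \<delta> that unfolding continuous_on_iff dist_real_def by blast
  qed
  obtain B where B: "\<And>x. x \<in> {-1..1} \<Longrightarrow> \<bar>u x\<bar> \<le> B"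
    using compact_imp_bounded[OF compact_continuous_image[OF cont compact_Icc]]
    unfolding bounded_iff by (metis image_eqI real_norm_def)
  define C where "C = (\<bar>B\<bar> + \<delta>) / \<eta>"
  have C: "C \<ge> 0" using \<delta> \<eta> by (simp add: C_def)
  \<comment> \<open>If \<open>u 1 < 0\<close>, then \<open>u\<close> lies below a line that is negative at \<open>1\<close>.\<close>
  have bound: "u x \<le> - \<delta> + C * (1 - x)" if x: "x \<in> {-1..1}" for x
  proof (cases "\<bar>x - 1\<bar> < \<eta>")
    case True
    have "u x \<le> - \<delta>" using near[OF x True] by (simp add: \<delta>_def abs_if split: if_splits)
    moreover have "0 \<le> C * (1 - x)" using C x by simp
    ultimately show ?thesis by linarith
  next
    case False
    then have "\<eta> \<le> 1 - x" using x by auto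
    then have "C * \<eta> \<le> C * (1 - x)" using C by (rule mult_left_mono)
    moreover have "C * \<eta> = \<bar>B\<bar> + \<delta>" using \<eta> by (simp add: C_def)
    ultimately show ?thesis using B[OF x] by linarith
  qed
  have powers: "0 \<le> usp_int a (\<lambda>x. (u x * (1 + x) ^ m) * poly (usp a k) x)" for m k
  proof (induction m arbitrary: k)
    case (Suc m)
    have c: "continuous_on {-1..1} (\<lambda>x. u x * (1 + x) ^ m)"
      by (intro continuous_intros cont)
    have "usp_int a (\<lambda>x. (u x * (1 + x) ^ Suc m) * poly (usp a k) x) =
        usp_int a (\<lambda>x. (u x * (1 + x) ^ m) * poly (usp a k) x + x * (u x * (1 + x) ^ m) * poly (usp a k) x)"
      by (simp add: algebra_simps)
    also have "\<dots> = usp_int a (\<lambda>x. (u x * (1 + x) ^ m) * poly (usp a k) x)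
        + usp_int a (\<lambda>x. x * (u x * (1 + x) ^ m) * poly (usp a k) x)"
      by (intro usp_int_add continuous_intros cont)
    finally show ?case using Suc usp_coeffs_nonneg_mult_x[OF c Suc] by simp
  qed (use pos in simp)
  obtain m :: nat where m: "m > 0" "C * (real a + 1) < \<delta> * real m"
  proof -
    obtain m :: nat where "C * (real a + 1) / \<delta> < real m" using reals_Archimedean2 by blast
    then have "C * (real a + 1) < \<delta> * real m" using \<delta> by (simp add: field_simps)
    moreover have "0 \<le> C * (real a + 1)" using C by simp
    ultimately show ?thesis using that[of m] by (cases "m = 0") auto
  qed
  define I where "I = usp_int a (\<lambda>x. (1 + x) ^ m)"
  define J where "J = usp_int a (\<lambda>x. (1 - x) * (1 + x) ^ m)"
  have I: "I > 0" unfolding I_def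
    by (rule usp_int_pos[where x = 1]) (auto intro!: continuous_intros)
  have "real m * J \<le> (real a + 1) * I"
  proof -
    have "poly (pderiv ([:1, 1:] ^ m)) s = real m * (1 + s) ^ (m - 1)" for s :: real
      by (simp add: pderiv_power pderiv_pCons)
    moreover have "(1 - s\<^sup>2) * (real m * (1 + s) ^ (m - 1)) = real m * ((1 - s) * (1 + s) ^ m)" for s :: real
      using m(1) by (cases m) (auto simp: power2_eq_square algebra_simps)
    ultimately have "(1 - s\<^sup>2) * poly (pderiv ([:1, 1:] ^ m)) s = real m * ((1 - s) * (1 + s) ^ m)" for s
      by metis
    then have "0 = usp_int a (\<lambda>s. real m * ((1 - s) * (1 + s) ^ m) - (real a + 1) * (s * (1 + s) ^ m))"
      using usp_int_divergence[of a "[:1, 1:] ^ m"] by (simp add: mult.assoc)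
    also have "\<dots> = real m * J - (real a + 1) * usp_int a (\<lambda>s. s * (1 + s) ^ m)"
      unfolding J_def by (subst usp_int_diff) (auto intro!: continuous_intros simp: usp_int_cmult)
    finally have "real m * J = (real a + 1) * usp_int a (\<lambda>s. s * (1 + s) ^ m)" by simp
    also have "\<dots> \<le> (real a + 1) * I" unfolding I_def
    proof (intro mult_left_mono usp_int_mono)
      show "x * (1 + x) ^ m \<le> (1 + x) ^ m" if "x \<in> {-1..1}" for x :: real
        using mult_right_mono[of x 1 "(1 + x) ^ m"] that by simp
    qed (auto intro!: continuous_intros)
    finally show ?thesis .
  qed
  have "0 \<le> usp_int a (\<lambda>x. u x * (1 + x) ^ m)" using powers[of m 0] by simp
  also have "\<dots> \<le> usp_int a (\<lambda>x. C * ((1 - x) * (1 + x) ^ m) - \<delta> * (1 + x) ^ m)"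
  proof (rule usp_int_mono)
    show "u x * (1 + x) ^ m \<le> C * ((1 - x) * (1 + x) ^ m) - \<delta> * (1 + x) ^ m" if "x \<in> {-1..1}" for x
      using mult_right_mono[OF bound[OF that], of "(1 + x) ^ m"] that by (simp add: algebra_simps)
  qed (intro continuous_intros cont)+
  also have "\<dots> = C * J - \<delta> * I"
    unfolding I_def J_def by (subst usp_int_diff) (auto intro!: continuous_intros simp: usp_int_cmult)
  finally have "\<delta> * I \<le> C * J" by simp
  then have "real m * (\<delta> * I) \<le> C * (real m * J)"
    using mult_left_mono[of "\<delta> * I" "C * J" "real m"] by (simp add: mult_ac)
  also have "\<dots> \<le> C * ((real a + 1) * I)"
    by (intro mult_left_mono C) fact
  finally have "real m * \<delta> * I \<le> C * (real a + 1) * I" by (simp add: mult_ac)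
  then show False using m I by (simp add: mult.commute)
qed

lemma Weierstrass_poly:
  fixes f :: "real \<Rightarrow> real"
  assumes "compact S" "continuous_on S f" "0 < e"
  obtains p :: "real poly" where "\<And>x. x \<in> S \<Longrightarrow> \<bar>f x - poly p x\<bar> < e"
proof -
  obtain g where g: "real_polynomial_function g" "\<And>x. x \<in> S \<Longrightarrow> \<bar>f x - g x\<bar> < e"
    using Stone_Weierstrass_real_polynomial_function[OF assms] by blast
  obtain c n where "g = (\<lambda>x. \<Sum>i\<le>n. c i * x ^ i)"
    using g(1) real_polynomial_function_iff_sum by blast
  then have "g x = poly (\<Sum>i\<le>n. monom (c i) i) x" for x
    by (simp add: poly_sum poly_monom)
  then show ?thesis using that[of "\<Sum>i\<le>n. monom (c i) i"] g(2) by metis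
qed

lemma usp_coeffs_eq_0_imp:
  assumes cont: "continuous_on {-1..1} u"
    and zero: "\<And>k. usp_int a (\<lambda>x. u x * poly (usp a k) x) = 0"
    and x: "x \<in> {-1..1}"
  shows "u x = 0"
proof -
  have powers: "usp_int a (\<lambda>x. (x ^ m * u x) * poly (usp a k) x) = 0" for m k
  proof (induction m arbitrary: k)
    case (Suc m)
    have c: "continuous_on {-1..1} (\<lambda>x. x ^ m * u x)" "continuous_on {-1..1} (\<lambda>x. - (x ^ m * u x))"
      by (intro continuous_intros cont)+
    have "0 \<le> usp_int a (\<lambda>x. x * (x ^ m * u x) * poly (usp a k) x)"
      by (rule usp_coeffs_nonneg_mult_x[OF c(1)]) (simp add: Suc)
    moreover have "0 \<le> usp_int a (\<lambda>x. x * - (x ^ m * u x) * poly (usp a k) x)"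
      by (rule usp_coeffs_nonneg_mult_x[OF c(2)]) (simp add: Suc usp_int_minus)
    ultimately show ?case by (simp add: usp_int_minus mult.assoc)
  qed (use zero in simp)
  have poly: "usp_int a (\<lambda>x. u x * poly p x) = 0" for p
  proof -
    have "usp_int a (\<lambda>x. u x * poly p x) = usp_int a (\<lambda>x. \<Sum>i\<le>degree p. coeff p i * ((x ^ i * u x) * poly (usp a 0) x))"
      by (simp add: poly_altdef sum_distrib_left mult_ac)
    also have "\<dots> = 0"
      by (subst usp_int_sum) (auto intro!: continuous_intros cont simp: usp_int_cmult powers simp del: usp.simps)
    finally show ?thesis .
  qed
  define M where "M = usp_int a (\<lambda>x. \<bar>u x\<bar>)"
  have "usp_int a (\<lambda>x. u x * u x) \<le> 0"
  proof (rule field_le_epsilon)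
    fix e :: real assume "e > 0"
    have M: "0 \<le> M" unfolding M_def
      using usp_int_mono[of "\<lambda>_. 0" "\<lambda>x. \<bar>u x\<bar>" a] cont by (auto intro!: continuous_intros simp: usp_int_def)
    define d where "d = e / (M + 1)"
    have d: "d > 0" "d * M \<le> e" using \<open>e > 0\<close> M by (auto simp: d_def field_simps)
    obtain p where p: "\<And>x. x \<in> {-1..1} \<Longrightarrow> \<bar>u x - poly p x\<bar> < d"
      using Weierstrass_poly[OF compact_Icc cont d(1)] by blast
    have "usp_int a (\<lambda>x. u x * u x) = usp_int a (\<lambda>x. u x * u x - u x * poly p x)"
      by (subst usp_int_diff) (auto intro!: continuous_intros cont simp: poly)
    also have "\<dots> \<le> usp_int a (\<lambda>x. d * \<bar>u x\<bar>)"
    proof (rule usp_int_mono)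
      fix x :: real assume x: "x \<in> {-1..1}"
      have "u x * u x - u x * poly p x = u x * (u x - poly p x)" by (simp add: algebra_simps)
      also have "\<dots> \<le> \<bar>u x\<bar> * \<bar>u x - poly p x\<bar>" by (metis abs_ge_self abs_mult)
      also have "\<dots> \<le> \<bar>u x\<bar> * d" using p[OF x] by (intro mult_left_mono) auto
      finally show "u x * u x - u x * poly p x \<le> d * \<bar>u x\<bar>" by (simp add: mult.commute)
    qed (intro continuous_intros cont)+
    also have "\<dots> = d * M" by (simp add: usp_int_cmult M_def)
    finally show "usp_int a (\<lambda>x. u x * u x) \<le> 0 + e" using d by simp
  qed
  moreover have "0 \<le> usp_int a (\<lambda>x. u x * u x)"
    using usp_int_mono[of "\<lambda>_. 0" "\<lambda>x. u x * u x" a] cont by (auto intro!: continuous_intros simp: usp_int_def)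
  ultimately have "usp_int a (\<lambda>x. u x * u x) = 0" by simp
  then have "u x * u x = 0"
    using usp_int_eq_0_imp[of "\<lambda>x. u x * u x" a x] continuous_on_mult[OF cont cont] x by simp
  then show ?thesis by simp
qed

section \<open>Positive definite functions have nonnegative integral\<close>

lemma second_derivative_at_max:
  fixes h :: "real \<Rightarrow> real"
  assumes h: "\<And>s. (h has_real_derivative h' s) (at s)"
    and h'': "(h' has_real_derivative h'') (at 0)"
    and max: "\<And>s. h s \<le> h 0"
  shows "h'' \<le> 0"
proof (rule ccontr)
  assume "\<not> h'' \<le> 0"
  have h'0: "h' 0 = 0"
    using DERIV_local_max[OF h[of 0], of 1] max by simp
  obtain d where d: "d > 0" "\<And>s. 0 < s \<Longrightarrow> s < d \<Longrightarrow> h' 0 < h' (0 + s)"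
    using DERIV_pos_inc_right[OF h''] \<open>\<not> h'' \<le> 0\<close> by auto
  have "0 < d / 2" using d by simp
  from MVT2[OF this h] obtain z where z: "0 < z" "z < d / 2" "h (d / 2) - h 0 = (d / 2 - 0) * h' z"
    by blast
  have "h' z > 0" using d(2)[of z] h'0 z d(1) by simp
  then have "(d / 2 - 0) * h' z > 0" using d(1) by simp
  then have "h (d / 2) > h 0" using z(3) by linarith
  then show False using max[of "d / 2"] by simp
qed

text \<open>
  A maximum principle: at a maximum point \<open>x\<close> on the sphere of \<open>W x = \<Sum>i. q (z i \<bullet> x)\<close>, the
  spherical Laplacian of \<open>W\<close> is nonpositive. The Laplacian is obtained as the sum of the second
  derivatives of \<open>W\<close> along the great circles with velocities \<open>tangent_part b x\<close>, where \<open>b\<close> runs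
  through the basis of the ambient space.
\<close>

lemma sum_usp_lap_nonpos:
  fixes z :: "nat \<Rightarrow> 'e::euclidean_space"
  assumes dim: "DIM('e) = a + 2" and z: "\<And>i. i < N \<Longrightarrow> z i \<in> sphere 0 1"
  shows "\<exists>x\<in>sphere 0 1. (\<Sum>i<N. poly (usp_lap a q) (z i \<bullet> x)) \<le> 0"
proof -
  define W where "W x = (\<Sum>i<N. poly q (z i \<bullet> x))" for x
  have "continuous_on (sphere 0 1) W" unfolding W_def
    by (intro continuous_intros)
  moreover have "sphere (0::'e) 1 \<noteq> {}" using dim by simp
  ultimately obtain x where x: "x \<in> sphere 0 1" and max: "\<And>y. y \<in> sphere 0 1 \<Longrightarrow> W y \<le> W x"
    using continuous_attains_sup[of "sphere (0::'e) 1" W] by auto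
  define t where "t i = z i \<bullet> x" for i
  have xn: "x \<bullet> x = 1" using x by (simp add: dot_square_norm)
  have dir: "(\<Sum>i<N. poly (pderiv (pderiv q)) (t i) * (z i \<bullet> v)\<^sup>2 - (norm v)\<^sup>2 * t i * poly (pderiv q) (t i)) \<le> 0"
    if v: "x \<bullet> v = 0" for v
  proof (cases "v = 0")
    case False
    define c where "c = norm v"
    have c: "c > 0" using False by (simp add: c_def)
    define \<gamma> where "\<gamma> i s = cos (c * s) * t i + sin (c * s) / c * (z i \<bullet> v)" for i s
    define \<gamma>' where "\<gamma>' i s = - (c * sin (c * s)) * t i + cos (c * s) * (z i \<bullet> v)" for i s
    have \<gamma>: "(\<gamma> i has_real_derivative \<gamma>' i s) (at s)" for i s
      unfolding \<gamma>_def[abs_def] \<gamma>'_def using c by (auto intro!: derivative_eq_intros)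
    have \<gamma>': "(\<gamma>' i has_real_derivative - (c\<^sup>2 * t i)) (at 0)" for i
      unfolding \<gamma>'_def[abs_def] by (auto intro!: derivative_eq_intros simp: power2_eq_square)
    have \<gamma>0: "\<gamma> i 0 = t i" "\<gamma>' i 0 = z i \<bullet> v" for i by (auto simp: \<gamma>_def \<gamma>'_def)
    have poly_\<gamma>: "((\<lambda>s. poly p (\<gamma> i s)) has_real_derivative poly (pderiv p) (\<gamma> i s) * \<gamma>' i s) (at s)" for p i s
      by (rule DERIV_chain2[OF poly_DERIV \<gamma>])
    have W\<gamma>: "W (great_circle x v s) = (\<Sum>i<N. poly q (\<gamma> i s))" for s
      unfolding W_def great_circle_def \<gamma>_def t_def c_def by (simp add: inner_add_right)
    have "(\<Sum>i<N. poly (pderiv q) (t i) * - (c\<^sup>2 * t i) + poly (pderiv (pderiv q)) (t i) * (z i \<bullet> v) * (z i \<bullet> v)) \<le> 0"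
    proof (rule second_derivative_at_max)
      show "((\<lambda>s. \<Sum>i<N. poly q (\<gamma> i s)) has_real_derivative
          (\<Sum>i<N. poly (pderiv q) (\<gamma> i s) * \<gamma>' i s)) (at s)" for s
        by (intro DERIV_sum poly_\<gamma>)
      show "((\<lambda>s. \<Sum>i<N. poly (pderiv q) (\<gamma> i s) * \<gamma>' i s) has_real_derivative
          (\<Sum>i<N. poly (pderiv q) (t i) * - (c\<^sup>2 * t i)
             + poly (pderiv (pderiv q)) (t i) * (z i \<bullet> v) * (z i \<bullet> v))) (at 0)"
        by (intro DERIV_sum) (use DERIV_mult'[OF poly_\<gamma>[where s = 0] \<gamma>'] in \<open>simp add: \<gamma>0\<close>)
      show "(\<Sum>i<N. poly q (\<gamma> i s)) \<le> (\<Sum>i<N. poly q (\<gamma> i 0))" for s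
        using max[OF great_circle_in_sphere[of x v s]] x v False unfolding W\<gamma>[symmetric] by simp
    qed
    then show ?thesis by (simp add: c_def power2_eq_square algebra_simps)
  qed simp
  have "(\<Sum>i<N. poly (usp_lap a q) (t i)) =
      (\<Sum>i<N. \<Sum>b\<in>Basis. poly (pderiv (pderiv q)) (t i) * (z i \<bullet> tangent_part b x)\<^sup>2
         - (norm (tangent_part b x))\<^sup>2 * t i * poly (pderiv q) (t i))"
  proof (rule sum.cong[OF refl])
    fix i assume "i \<in> {..<N}"
    then have zn: "z i \<bullet> z i = 1" using z by (simp add: dot_square_norm)
    have "(\<Sum>b\<in>Basis. (z i \<bullet> tangent_part b x)\<^sup>2) =
        (\<Sum>b\<in>Basis. (z i \<bullet> b) * (z i \<bullet> b) - 2 * t i * ((x \<bullet> b) * (z i \<bullet> b)) + (t i)\<^sup>2 * ((x \<bullet> b) * (x \<bullet> b)))"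
      by (intro sum.cong) (auto simp: tangent_part_def inner_diff_right power2_eq_square t_def algebra_simps)
    also have "\<dots> = 1 - (t i)\<^sup>2"
      using zn xn by (simp add: sum.distrib sum_subtractf sum_distrib_left[symmetric] sum_inner_Basis
          t_def inner_commute[of x "z i"] power2_eq_square)
    finally have 1: "(\<Sum>b\<in>Basis. (z i \<bullet> tangent_part b x)\<^sup>2) = 1 - (t i)\<^sup>2" .
    have "(\<Sum>b\<in>Basis. (norm (tangent_part b x))\<^sup>2) = (\<Sum>b\<in>Basis. 1 - (x \<bullet> b) * (x \<bullet> b))"
      by (intro sum.cong) (auto simp: tangent_part_def power2_norm_eq_inner inner_diff_right
          inner_diff_left xn inner_commute algebra_simps)
    also have "\<dots> = real a + 1"
      using xn dim by (simp add: sum_subtractf sum_inner_Basis)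
    finally have 2: "(\<Sum>b\<in>Basis. (norm (tangent_part b x))\<^sup>2) = real a + 1" .
    show "poly (usp_lap a q) (t i) = (\<Sum>b\<in>Basis. poly (pderiv (pderiv q)) (t i) * (z i \<bullet> tangent_part b x)\<^sup>2
         - (norm (tangent_part b x))\<^sup>2 * t i * poly (pderiv q) (t i))"
      unfolding sum_subtractf sum_distrib_left[symmetric] sum_distrib_right[symmetric] 1 2 poly_usp_lap
      by (simp add: mult.commute)
  qed
  also have "\<dots> \<le> 0"
    by (subst sum.swap) (use x in \<open>intro sum_nonpos dir inner_tangent_part, simp\<close>)
  finally show ?thesis using x unfolding t_def by blast
qed

text \<open>
  A greedy choice of points: each new point is the one from the maximum principle for the
  previous points, so that it adds at most the diagonal term \<open>poly (usp_lap a q) 1\<close> to the double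
  sum. Hence the mean of the kernel over the \<open>N\<^sup>2\<close> pairs of points has an upper bound of order
  \<open>1/N\<close>.
\<close>

lemma equidistributed_points:
  assumes dim: "DIM('e::euclidean_space) = a + 2"
  shows "\<exists>z :: nat \<Rightarrow> 'e. (\<forall>i<N. z i \<in> sphere 0 1) \<and>
    (\<Sum>i<N. \<Sum>j<N. poly (usp_lap a q) (z i \<bullet> z j)) \<le> real N * poly (usp_lap a q) 1"
proof (induction N)
  case (Suc N)
  then obtain z :: "nat \<Rightarrow> 'e" where z: "\<And>i. i < N \<Longrightarrow> z i \<in> sphere 0 1"
    and le: "(\<Sum>i<N. \<Sum>j<N. poly (usp_lap a q) (z i \<bullet> z j)) \<le> real N * poly (usp_lap a q) 1" by blast
  obtain x where x: "x \<in> sphere 0 1" and xle: "(\<Sum>i<N. poly (usp_lap a q) (z i \<bullet> x)) \<le> 0"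
    using sum_usp_lap_nonpos[OF dim, of N z q] z by blast
  have "(\<Sum>i<Suc N. \<Sum>j<Suc N. poly (usp_lap a q) ((z(N := x)) i \<bullet> (z(N := x)) j)) =
      (\<Sum>i<N. \<Sum>j<N. poly (usp_lap a q) (z i \<bullet> z j)) + (\<Sum>i<N. poly (usp_lap a q) (z i \<bullet> x))
      + (\<Sum>i<N. poly (usp_lap a q) (x \<bullet> z i)) + poly (usp_lap a q) (x \<bullet> x)"
    by (simp add: sum.distrib)
  also have "\<dots> \<le> real (Suc N) * poly (usp_lap a q) 1"
    using le xle x by (simp add: inner_commute[of x] dot_square_norm algebra_simps)
  finally show ?case using z x by (intro exI[of _ "z(N := x)"]) (auto simp: less_Suc_eq)
qed simp

text \<open>
  A monomial of degree \<open>m > 0\<close> is, up to a monomial of degree \<open>m - 2\<close>, a multiple of its own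
  image under \<open>usp_lap a\<close>.
\<close>

lemma poly_eq_const_plus_usp_lap: "\<exists>q c. p = [:c:] + usp_lap a q"
proof -
  have add: "\<exists>r c. p + q = [:c:] + usp_lap a r"
    if "\<exists>r c. p = [:c:] + usp_lap a r" "\<exists>r c. q = [:c:] + usp_lap a r" for p q
  proof -
    from that obtain r r' c c' where "p = [:c:] + usp_lap a r" "q = [:c':] + usp_lap a r'" by blast
    then have "p + q = [:c + c':] + usp_lap a (r + r')" by (simp add: usp_lap_add)
    then show ?thesis by blast
  qed
  have smult: "\<exists>r c. smult e p = [:c:] + usp_lap a r" if "\<exists>r c. p = [:c:] + usp_lap a r" for e p
  proof -
    from that obtain r c where "p = [:c:] + usp_lap a r" by blast
    then have "smult e p = [:e * c:] + usp_lap a (smult e r)"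
      by (simp add: usp_lap_smult smult_add_right)
    then show ?thesis by blast
  qed
  have zero: "\<exists>r c. [:e:] = [:c:] + usp_lap a r" for e
    by (intro exI[of _ 0] exI[of _ e]) (simp add: usp_lap_def)
  have monom: "\<exists>r c. [:0, 1:] ^ m = [:c:] + usp_lap a r" for m
  proof (induction m rule: less_induct)
    case (less m)
    show ?case
    proof (cases "m = 0")
      case True
      then show ?thesis using zero[of 1] by (simp add: one_pCons)
    next
      case False
      let ?X = "[:0, 1:] :: real poly"
      define e where "e = real m * (real m + real a)"
      have e: "e > 0" using False by (simp add: e_def)
      have low: "\<exists>r c. smult (real m * (real m - 1)) (?X ^ (m - 2)) = [:c:] + usp_lap a r"
        using less.IH[of "m - 2"] smult False by (cases "m = 1") (use zero[of 0] in auto)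
      have d1: "poly (pderiv (?X ^ m)) t = real m * t ^ (m - 1)" for t
        by (simp add: pderiv_power pderiv_pCons)
      have "pderiv (?X ^ m) = smult (real m) (?X ^ (m - 1))"
        by (rule poly_ext) (simp add: d1)
      then have d2: "poly (pderiv (pderiv (?X ^ m))) t = real m * (real (m - 1) * t ^ (m - 2))" for t
        by (simp add: pderiv_smult pderiv_power pderiv_pCons numeral_2_eq_2)
      have "smult e (?X ^ m) = smult (real m * (real m - 1)) (?X ^ (m - 2)) + smult (-1) (usp_lap a (?X ^ m))"
      proof (rule poly_ext)
        fix t
        have low: "(real m - 1) * (t\<^sup>2 * t ^ (m - 2)) = (real m - 1) * t ^ m" and pow: "t * t ^ (m - 1) = t ^ m"
          using False by (cases m; cases "m - 1"; simp add: power2_eq_square)+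
        have "poly (smult (real m * (real m - 1)) (?X ^ (m - 2)) + smult (-1) (usp_lap a (?X ^ m))) t
            = real m * ((real m - 1) * (t\<^sup>2 * t ^ (m - 2))) + (real a + 1) * real m * (t * t ^ (m - 1))"
          unfolding poly_smult poly_add poly_usp_lap d1 d2 poly_power using False
          by (simp add: of_nat_diff algebra_simps)
        also have "\<dots> = poly (smult e (?X ^ m)) t"
          unfolding low pow e_def by (simp add: poly_power algebra_simps)
        finally show "poly (smult e (?X ^ m)) t =
            poly (smult (real m * (real m - 1)) (?X ^ (m - 2)) + smult (-1) (usp_lap a (?X ^ m))) t" ..
      qed
      then have "?X ^ m = smult (1 / e) (smult (real m * (real m - 1)) (?X ^ (m - 2))
          + ([:0:] + usp_lap a (smult (-1) (?X ^ m))))"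
        using e by (metis (no_types, lifting) add_0 less_irrefl nonzero_eq_divide_eq pCons_0_0
            smult_1_left smult_smult usp_lap_smult)
      then show ?thesis using smult[OF add[OF low]] by metis
    qed
  qed
  have "\<exists>r c. (\<Sum>i\<le>n. smult (coeff p i) ([:0, 1:] ^ i)) = [:c:] + usp_lap a r" for n
    by (induction n) (auto intro!: add smult monom simp del: power.simps)
  moreover have "p = (\<Sum>i\<le>degree p. smult (coeff p i) ([:0, 1:] ^ i))"
    by (rule poly_ext) (simp add: poly_sum poly_altdef[of p])
  ultimately show ?thesis by metis
qed

text \<open>
  Positive definiteness on the sphere is used only for equal weights. A uniform polynomial
  approximation of \<open>g\<close> is \<open>c + usp_lap a q\<close>; its weighted mean is \<open>c\<close>, and the means of \<open>g\<close> over
  all pairs of the greedily chosen points show that \<open>c\<close> is nonnegative up to the approximation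
  error.
\<close>

lemma usp_int_nonneg_if_pd:
  assumes dim: "DIM('e::euclidean_space) = a + 2" and cont: "continuous_on {-1..1} g"
    and pd: "\<And>N (z :: nat \<Rightarrow> 'e). (\<And>i. i < N \<Longrightarrow> z i \<in> sphere 0 1) \<Longrightarrow>
      0 \<le> (\<Sum>i<N. \<Sum>j<N. g (z i \<bullet> z j))"
  shows "0 \<le> usp_int a g"
proof (rule field_le_epsilon)
  fix e :: real assume "e > 0"
  define I where "I = usp_int a (\<lambda>_. 1)"
  have I: "I > 0" unfolding I_def by (rule usp_int_pos[where x = 0]) auto
  define \<epsilon> where "\<epsilon> = e / (2 * I)"
  have \<epsilon>: "\<epsilon> > 0" using \<open>e > 0\<close> I by (simp add: \<epsilon>_def)
  obtain p where p: "\<And>x. x \<in> {-1..1} \<Longrightarrow> \<bar>g x - poly p x\<bar> < \<epsilon>"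
    using Weierstrass_poly[OF compact_Icc cont \<epsilon>] by blast
  obtain q c where pq: "p = [:c:] + usp_lap a q" using poly_eq_const_plus_usp_lap by blast
  define \<kappa> where "\<kappa> = poly (usp_lap a q) 1"
  have "- \<kappa> / real N \<le> c + \<epsilon>" if N: "N > 0" for N
  proof -
    obtain z :: "nat \<Rightarrow> 'e" where z: "\<And>i. i < N \<Longrightarrow> z i \<in> sphere 0 1"
      and le: "(\<Sum>i<N. \<Sum>j<N. poly (usp_lap a q) (z i \<bullet> z j)) \<le> real N * \<kappa>"
      using equidistributed_points[OF dim, of N q] unfolding \<kappa>_def by blast
    have "0 \<le> (\<Sum>i<N. \<Sum>j<N. g (z i \<bullet> z j))" by (rule pd[OF z])
    also have "\<dots> \<le> (\<Sum>i<N. \<Sum>j<N. (c + \<epsilon>) + poly (usp_lap a q) (z i \<bullet> z j))"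
    proof (intro sum_mono)
      fix i j assume "i \<in> {..<N}" "j \<in> {..<N}"
      then have "\<bar>z i \<bullet> z j\<bar> \<le> 1"
        using Cauchy_Schwarz_ineq2[of "z i" "z j"] z by simp
      then show "g (z i \<bullet> z j) \<le> (c + \<epsilon>) + poly (usp_lap a q) (z i \<bullet> z j)"
        using p[of "z i \<bullet> z j"] unfolding pq by (simp add: abs_le_iff)
    qed
    also have "\<dots> \<le> real N * (real N * (c + \<epsilon>)) + real N * \<kappa>"
      using le by (simp add: sum.distrib)
    finally have "0 \<le> real N * (real N * (c + \<epsilon>) + \<kappa>)" by (simp add: algebra_simps)
    then have "0 \<le> real N * (c + \<epsilon>) + \<kappa>" using N by (simp add: zero_le_mult_iff)
    then show ?thesis using N by (simp add: field_simps)
  qed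
  moreover have "(\<lambda>N. - \<kappa> / real N) \<longlonglongrightarrow> 0"
    by (rule lim_const_over_n)
  ultimately have c: "0 \<le> c + \<epsilon>"
    by (intro LIMSEQ_le_const2 exI[of _ 1]) auto
  have "2 * \<epsilon> * I = e" using I by (simp add: \<epsilon>_def)
  have "usp_int a (poly p) = c * I"
  proof -
    have "usp_int a (poly p) = usp_int a (\<lambda>x. c * 1 + poly (usp_lap a q) x)"
      unfolding pq by (rule usp_int_cong) simp
    also have "\<dots> = c * I"
      by (subst usp_int_add) (auto intro!: continuous_intros simp: usp_int_lap I_def usp_int_cmult[of a c "\<lambda>_. 1", simplified])
    finally show ?thesis .
  qed
  moreover have "usp_int a (\<lambda>x. poly p x - \<epsilon> * 1) \<le> usp_int a g"
    by (intro usp_int_mono continuous_intros cont) (use p in \<open>force simp: abs_less_iff\<close>)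
  moreover have "usp_int a (\<lambda>x. poly p x - \<epsilon> * 1) = usp_int a (poly p) - \<epsilon> * I"
    by (subst usp_int_diff) (auto intro!: continuous_intros simp: I_def usp_int_cmult[of a \<epsilon> "\<lambda>_. 1", simplified])
  moreover have "- \<epsilon> * I \<le> c * I" using c I by (intro mult_right_mono) auto
  ultimately show "0 \<le> usp_int a g + e" using \<open>2 * \<epsilon> * I = e\<close> by linarith
qed

section \<open>Schoenberg's expansion on the product of a sphere and a Euclidean space\<close>

lemma positive_definite_on_finite:
  assumes pd: "positive_definite_on A C" and I: "finite I" and p: "\<And>i. i \<in> I \<Longrightarrow> p i \<in> A"
  shows "0 \<le> (\<Sum>i\<in>I. \<Sum>j\<in>I. b i * C (p i) (p j) * b j)"
proof -
  obtain h where h: "bij_betw h {..<card I} I"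
    using ex_bij_betw_nat_finite[OF I] by (auto simp: lessThan_atLeast0)
  have "p (h i) \<in> A" if "i < card I" for i
    using p h that by (auto simp: bij_betw_def)
  then have "0 \<le> (\<Sum>i<card I. \<Sum>j<card I. b (h i) * C (p (h i)) (p (h j)) * b (h j))"
    using pd[unfolded positive_definite_on_def, rule_format, of "card I" "p \<circ> h" "b \<circ> h"] by simp
  also have "\<dots> = (\<Sum>i<card I. \<Sum>j\<in>I. b (h i) * C (p (h i)) (p j) * b j)"
    by (intro sum.cong refl sum.reindex_bij_betw[OF h])
  also have "\<dots> = (\<Sum>i\<in>I. \<Sum>j\<in>I. b i * C (p i) (p j) * b j)"
    by (rule sum.reindex_bij_betw[OF h])
  finally show ?thesis .
qed

lemma cos_geodist:
  assumes "x \<in> sphere 0 1" "y \<in> sphere 0 1"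
  shows "cos (geodist x y) = x \<bullet> y"
  using Cauchy_Schwarz_ineq2[of x y] assms unfolding geodist_def
  by (intro cos_arccos) (auto simp: abs_le_iff)

lemma pd_class_continuous_on_fst:
  assumes "\<phi> \<in> pd_class TYPE('a::euclidean_space) TYPE('b::euclidean_space)" "0 \<le> t"
  shows "continuous_on {-1..1} (\<lambda>x. \<phi> x t)"
proof -
  have "continuous_on ({-1..1} \<times> {0..}) (\<lambda>(x, t). \<phi> x t)" using assms by (simp add: pd_class_def)
  then have "continuous_on {-1..1} (\<lambda>x. case (x, t) of (x, t) \<Rightarrow> \<phi> x t)"
    by (rule continuous_on_compose2) (use assms(2) in \<open>auto intro!: continuous_intros\<close>)
  then show ?thesis by simp
qed

text \<open>
  The squared norm of an ultraspherical polynomial with respect to its weight.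
\<close>

definition usp_norm :: "nat \<Rightarrow> nat \<Rightarrow> real" where
  "usp_norm a n = usp_int a (\<lambda>s. poly (usp a n) s * poly (usp a n) s)"

text \<open>
  The coefficient of the ultraspherical polynomial of degree \<open>n\<close> in the expansion of the function
  \<open>x \<mapsto> \<phi> x t\<close>.
\<close>

definition usp_coeff :: "nat \<Rightarrow> (real \<Rightarrow> real \<Rightarrow> real) \<Rightarrow> nat \<Rightarrow> real \<Rightarrow> real" where
  "usp_coeff a \<phi> n t = usp_int a (\<lambda>x. \<phi> x t * poly (usp a n) x) / usp_norm a n"

lemma usp_norm_gt_0: "usp_norm a n > 0"
  unfolding usp_norm_def by (rule usp_norm_pos)

lemma usp_int_usp_usp:
  "usp_int a (\<lambda>s. poly (usp a n) s * poly (usp a k) s) = (if n = k then usp_norm a n else 0)"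
  using usp_orthogonal by (auto simp: usp_norm_def)

lemma usp_int_coeff: "usp_int a (\<lambda>x. \<phi> x t * poly (usp a n) x) = usp_coeff a \<phi> n t * usp_norm a n"
  using usp_norm_gt_0[of a n] by (simp add: usp_coeff_def)

text \<open>
  The coefficients are positive definite radial functions on \<open>\<real>\<^sup>k\<close>. For fixed points \<open>y i\<close> and
  weights \<open>b i\<close>, the function \<open>g x = \<Sum>i j. b i * b j * \<phi> x (norm (y i - y j))\<close> induces a positive
  definite kernel on the sphere, as one sees by testing \<open>\<phi>\<close> with product systems of points and
  weights. By the Schur product theorem the same holds for \<open>g P\<^sub>n\<close>, so its integral is nonnegative.
\<close>

lemma usp_coeff_pd:
  fixes y :: "nat \<Rightarrow> 'b::euclidean_space"
  assumes dim: "DIM('a::euclidean_space) = a + 2" and \<phi>: "\<phi> \<in> pd_class TYPE('a) TYPE('b)"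
  shows "0 \<le> (\<Sum>i<N. \<Sum>j<N. b i * usp_coeff a \<phi> n (norm (y i - y j)) * b j)"
proof -
  let ?P = "poly (usp a n)"
  note cont = pd_class_continuous_on_fst[OF \<phi>]
  have pd: "positive_definite_on (sphere (0::'a) 1 \<times> (UNIV::'b set))
       (\<lambda>(x, y) (x', y'). \<phi> (cos (geodist x x')) (norm (y - y')))"
    using \<phi> by (simp add: pd_class_def)
  define g where "g x = (\<Sum>i<N. \<Sum>j<N. b i * b j * \<phi> x (norm (y i - y j)))" for x
  have "0 \<le> usp_int a (\<lambda>x. g x * ?P x)"
  proof (rule usp_int_nonneg_if_pd[OF dim])
    show "continuous_on {-1..1} (\<lambda>x. g x * ?P x)"
      unfolding g_def by (intro continuous_intros cont) auto
    fix M and z :: "nat \<Rightarrow> 'a" assume z: "\<And>i. i < M \<Longrightarrow> z i \<in> sphere 0 1"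
    have "0 \<le> (\<Sum>r<M. \<Sum>s<M. c r * g (z r \<bullet> z s) * c s)" for c
    proof -
      \<comment> \<open>The system of points \<open>(z r, y i)\<close> with weights \<open>c r * b i\<close>.\<close>
      define p where "p q = (z (fst q), y (snd q))" for q
      define e where "e q = c (fst q) * b (snd q)" for q
      have geo: "cos (geodist (z r) (z s)) = z r \<bullet> z s" if "r < M" "s < M" for r s
        by (intro cos_geodist z that)
      have "0 \<le> (\<Sum>q\<in>{..<M} \<times> {..<N}. \<Sum>q'\<in>{..<M} \<times> {..<N}. e q *
          (\<lambda>(x, y) (x', y'). \<phi> (cos (geodist x x')) (norm (y - y'))) (p q) (p q') * e q')"
        by (rule positive_definite_on_finite[OF pd]) (auto simp: p_def z[simplified])
      also have "\<dots> = (\<Sum>r<M. \<Sum>i<N. \<Sum>s<M. \<Sum>j<N.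
          c r * b i * \<phi> (z r \<bullet> z s) (norm (y i - y j)) * (c s * b j))"
        unfolding sum.cartesian_product' p_def e_def
        by (intro sum.cong refl) (simp add: geo)
      also have "\<dots> = (\<Sum>r<M. \<Sum>s<M. \<Sum>i<N. \<Sum>j<N.
          c r * b i * \<phi> (z r \<bullet> z s) (norm (y i - y j)) * (c s * b j))"
        by (intro sum.cong refl sum.swap)
      also have "\<dots> = (\<Sum>r<M. \<Sum>s<M. c r * g (z r \<bullet> z s) * c s)"
        unfolding g_def sum_distrib_left sum_distrib_right by (intro sum.cong refl) (simp add: mult_ac)
      finally show ?thesis .
    qed
    from usp_gram_nonneg[OF dim z this, where n = n and c = "\<lambda>_. 1"]
    show "0 \<le> (\<Sum>r<M. \<Sum>s<M. g (z r \<bullet> z s) * ?P (z r \<bullet> z s))" by simp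
  qed
  also have "usp_int a (\<lambda>x. g x * ?P x)
      = usp_int a (\<lambda>x. \<Sum>i<N. \<Sum>j<N. b i * b j * (\<phi> x (norm (y i - y j)) * ?P x))"
    by (simp add: g_def sum_distrib_right sum_distrib_left mult_ac)
  also have "\<dots> = (\<Sum>i<N. usp_int a (\<lambda>x. \<Sum>j<N. b i * b j * (\<phi> x (norm (y i - y j)) * ?P x)))"
    by (intro usp_int_sum continuous_intros cont) auto
  also have "\<dots> = (\<Sum>i<N. \<Sum>j<N. b i * b j * usp_int a (\<lambda>x. \<phi> x (norm (y i - y j)) * ?P x))"
    by (subst usp_int_sum) (auto intro!: continuous_intros cont simp: usp_int_cmult)
  also have "\<dots> = (\<Sum>i<N. \<Sum>j<N. b i * usp_coeff a \<phi> n (norm (y i - y j)) * b j) * usp_norm a n"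
    unfolding usp_int_coeff by (simp add: sum_distrib_right sum_distrib_left mult_ac)
  finally show ?thesis using usp_norm_gt_0[of a n] by (simp add: zero_le_mult_iff)
qed

lemma usp_coeff_nonneg:
  assumes dim: "DIM('a::euclidean_space) = a + 2"
    and \<phi>: "\<phi> \<in> pd_class TYPE('a) TYPE('b::euclidean_space)"
  shows "0 \<le> usp_coeff a \<phi> n 0"
  using usp_coeff_pd[OF dim \<phi>, where N = 1 and b = "\<lambda>_. 1" and n = n and y = "\<lambda>_. 0"] by simp

lemma abs_usp_coeff_le:
  assumes dim: "DIM('a::euclidean_space) = a + 2"
    and \<phi>: "\<phi> \<in> pd_class TYPE('a) TYPE('b::euclidean_space)" and t: "0 \<le> t"
  shows "\<bar>usp_coeff a \<phi> n t\<bar> \<le> usp_coeff a \<phi> n 0"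
proof -
  obtain v :: 'b where v: "norm v = t" using vector_choose_size[OF t] .
  define y where "y i = (if i = 0 then v else 0)" for i :: nat
  have "0 \<le> (\<Sum>i<2. \<Sum>j<2. b i * usp_coeff a \<phi> n (norm (y i - y j)) * b j)" for b
    by (rule usp_coeff_pd[OF dim \<phi>])
  from this[of "\<lambda>_. 1"] this[of "\<lambda>i. if i = 0 then 1 else -1"]
  show ?thesis by (simp add: numeral_2_eq_2 y_def v)
qed

text \<open>
  Subtracting a partial sum of the expansion from \<open>\<phi> x 0\<close> leaves a function with nonnegative
  coefficients, whose value at \<open>1\<close> is nonnegative.
\<close>

lemma sum_usp_coeff_le:
  assumes dim: "DIM('a::euclidean_space) = a + 2"
    and \<phi>: "\<phi> \<in> pd_class TYPE('a) TYPE('b::euclidean_space)"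
  shows "(\<Sum>n<N. usp_coeff a \<phi> n 0) \<le> \<phi> 1 0"
proof -
  let ?c = "\<lambda>n. usp_coeff a \<phi> n 0"
  note cont = pd_class_continuous_on_fst[OF \<phi>]
  define u where "u x = \<phi> x 0 - (\<Sum>n<N. ?c n * poly (usp a n) x)" for x
  have cu: "continuous_on {-1..1} u" unfolding u_def by (intro continuous_intros cont) auto
  have "0 \<le> usp_int a (\<lambda>x. u x * poly (usp a k) x)" for k
  proof -
    have "usp_int a (\<lambda>x. u x * poly (usp a k) x) = usp_int a (\<lambda>x. \<phi> x 0 * poly (usp a k) x
        - (\<Sum>n<N. ?c n * (poly (usp a n) x * poly (usp a k) x)))"
      by (simp add: u_def left_diff_distrib sum_distrib_right mult.assoc)
    also have "\<dots> = ?c k * usp_norm a k - (\<Sum>n<N. ?c n * (if n = k then usp_norm a n else 0))"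
      by (subst usp_int_diff, (intro continuous_intros cont; simp)+, subst usp_int_sum)
         (auto intro!: continuous_intros simp: usp_int_coeff usp_int_cmult usp_int_usp_usp)
    also have "(\<Sum>n<N. ?c n * (if n = k then usp_norm a n else 0)) = (if k < N then ?c k * usp_norm a k else 0)"
      by (simp add: if_distrib[of "\<lambda>z. _ * z"] sum.delta' cong: if_cong)
    finally show ?thesis
      using usp_coeff_nonneg[OF dim \<phi>, of k] usp_norm_gt_0[of a k] by simp
  qed
  from usp_coeffs_nonneg_at_1[OF cu this] show ?thesis by (simp add: u_def)
qed

lemma summable_usp_coeff:
  assumes dim: "DIM('a::euclidean_space) = a + 2"
    and \<phi>: "\<phi> \<in> pd_class TYPE('a) TYPE('b::euclidean_space)"
  shows "summable (\<lambda>n. usp_coeff a \<phi> n 0)"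
  by (rule summableI_nonneg_bounded) (rule usp_coeff_nonneg[OF dim \<phi>] sum_usp_coeff_le[OF dim \<phi>])+

lemma usp_int_series:
  assumes cont: "\<And>n. continuous_on {-1..1} (g n)"
    and bound: "\<And>n x. x \<in> {-1..1} \<Longrightarrow> \<bar>g n x\<bar> \<le> M n" and M: "summable M"
  shows "continuous_on {-1..1} (\<lambda>x. \<Sum>n. g n x)"
    and "(\<lambda>n. usp_int a (g n)) sums usp_int a (\<lambda>x. \<Sum>n. g n x)"
proof -
  let ?F = "\<lambda>N x. \<Sum>n<N. g n x" and ?f = "\<lambda>x. \<Sum>n. g n x"
  have lim: "uniform_limit {-1..1} ?F ?f sequentially"
    by (rule Weierstrass_m_test[OF _ M]) (use bound in auto)
  have F: "continuous_on {-1..1} (?F N)" for N by (intro continuous_intros cont)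
  show f: "continuous_on {-1..1} ?f"
    by (rule uniform_limit_theorem[OF always_eventually[OF allI[OF F]] lim]) simp
  define I where "I = usp_int a (\<lambda>_. 1)"
  have I: "I > 0" unfolding I_def by (rule usp_int_pos[where x = 0]) auto
  have "(\<lambda>N. usp_int a (?F N)) \<longlonglongrightarrow> usp_int a ?f"
  proof (rule tendstoI)
    fix e :: real assume "e > 0"
    then have "e / (2 * I) > 0" using I by simp
    from uniform_limitD[OF lim this]
    show "\<forall>\<^sub>F N in sequentially. dist (usp_int a (?F N)) (usp_int a ?f) < e"
    proof eventually_elim
      case (elim N)
      then have *: "\<bar>?F N x - ?f x\<bar> \<le> e / (2 * I)" if "x \<in> {-1..1}" for x
        using that by (auto simp: dist_real_def intro: less_imp_le)
      have close: "?F N x - ?f x \<le> e / (2 * I) * 1" "- (e / (2 * I)) * 1 \<le> ?F N x - ?f x"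
        if "x \<in> {-1..1}" for x
        using *[OF that] unfolding abs_le_iff by linarith+
      have "usp_int a (?F N) - usp_int a ?f = usp_int a (\<lambda>x. ?F N x - ?f x)"
        by (rule usp_int_diff[symmetric]) (rule F f)+
      moreover have "usp_int a (\<lambda>x. ?F N x - ?f x) \<le> usp_int a (\<lambda>x. e / (2 * I) * 1)"
        by (rule usp_int_mono) (intro continuous_intros F f close; assumption)+
      moreover have "usp_int a (\<lambda>x. - (e / (2 * I)) * 1) \<le> usp_int a (\<lambda>x. ?F N x - ?f x)"
        by (rule usp_int_mono) (intro continuous_intros F f close; assumption)+
      ultimately have "\<bar>usp_int a (?F N) - usp_int a ?f\<bar> \<le> e / (2 * I) * I"
        unfolding usp_int_cmult I_def by linarith
      also have "\<dots> < e" using \<open>e > 0\<close> I by simp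
      finally show ?case by (simp add: dist_real_def)
    qed
  qed
  then show "(\<lambda>n. usp_int a (g n)) sums usp_int a ?f"
    unfolding sums_def by (simp add: usp_int_sum cont)
qed

text \<open>
  Schoenberg's expansion. The series converges uniformly in \<open>x\<close>, because its terms are bounded by
  the summable coefficients at \<open>t = 0\<close>; so its sum is a continuous function with the same
  coefficients as \<open>\<phi>\<close>.
\<close>

lemma pd_class_expansion:
  assumes dim: "DIM('a::euclidean_space) = a + 2"
    and \<phi>: "\<phi> \<in> pd_class TYPE('a) TYPE('b::euclidean_space)"
    and x: "x \<in> {-1..1}" and t: "0 \<le> t"
  shows "(\<lambda>n. usp_coeff a \<phi> n t * poly (usp a n) x) sums \<phi> x t"
proof -
  let ?c = "\<lambda>n. usp_coeff a \<phi> n t"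
  have bound: "\<bar>?c n * poly (usp a n) x\<bar> \<le> usp_coeff a \<phi> n 0" if "x \<in> {-1..1}" for n x
    unfolding abs_mult
    using mult_mono[OF abs_usp_coeff_le[OF dim \<phi> t, of n] abs_poly_usp_le_1[OF dim, of x n]] that
      usp_coeff_nonneg[OF dim \<phi>, of n] by simp
  note summ = summable_usp_coeff[OF dim \<phi>]
  have sm: "summable (\<lambda>n. ?c n * poly (usp a n) x)" if "x \<in> {-1..1}" for x
    by (rule summable_comparison_test'[OF summ, of 0]) (use bound[OF that] in simp)
  define S where "S x = (\<Sum>n. ?c n * poly (usp a n) x)" for x
  have S: "continuous_on {-1..1} S" unfolding S_def[abs_def]
    by (rule usp_int_series(1)[OF _ bound summ]) (auto intro!: continuous_intros)
  note cont = pd_class_continuous_on_fst[OF \<phi> t]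
  have "\<phi> x t - S x = 0"
  proof (rule usp_coeffs_eq_0_imp[where u = "\<lambda>x. \<phi> x t - S x" and a = a, OF _ _ x])
    fix k
    have "(\<lambda>n. usp_int a (\<lambda>x. ?c n * poly (usp a n) x * poly (usp a k) x)) sums
        usp_int a (\<lambda>x. \<Sum>n. ?c n * poly (usp a n) x * poly (usp a k) x)"
    proof (rule usp_int_series(2)[OF _ _ summ])
      show "\<bar>?c n * poly (usp a n) x * poly (usp a k) x\<bar> \<le> usp_coeff a \<phi> n 0" if "x \<in> {-1..1}" for n x
        unfolding abs_mult[of "_ * _"]
        using mult_mono[OF bound[OF that, of n] abs_poly_usp_le_1[OF dim, of x k]] that
          usp_coeff_nonneg[OF dim \<phi>, of n] by simp
    qed (auto intro!: continuous_intros)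
    moreover have "(\<lambda>n. usp_int a (\<lambda>x. ?c n * poly (usp a n) x * poly (usp a k) x))
        = (\<lambda>n. if n = k then ?c k * usp_norm a k else 0)"
      by (auto simp: fun_eq_iff mult.assoc usp_int_cmult usp_int_usp_usp)
    ultimately have "usp_int a (\<lambda>x. \<Sum>n. ?c n * poly (usp a n) x * poly (usp a k) x) = ?c k * usp_norm a k"
      using sums_unique2 sums_single[of k "\<lambda>_. ?c k * usp_norm a k"] by fastforce
    moreover have "usp_int a (\<lambda>x. \<Sum>n. ?c n * poly (usp a n) x * poly (usp a k) x)
        = usp_int a (\<lambda>x. S x * poly (usp a k) x)"
      by (rule usp_int_cong) (simp add: S_def suminf_mult2[OF sm])
    ultimately show "usp_int a (\<lambda>x. (\<phi> x t - S x) * poly (usp a k) x) = 0"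
      unfolding left_diff_distrib
      by (subst usp_int_diff) (auto intro!: continuous_intros cont S simp: usp_int_coeff)
  qed (intro continuous_intros cont S)
  then show ?thesis using summable_sums[OF sm[OF x]] by (simp add: S_def)
qed

lemma continuous_on_usp_coeff:
  assumes \<phi>: "\<phi> \<in> pd_class TYPE('a::euclidean_space) TYPE('b::euclidean_space)"
  shows "continuous_on {0..} (usp_coeff a \<phi> n)"
proof -
  have c: "continuous_on ({-1..1} \<times> {0..}) (\<lambda>(x, t). \<phi> x t)" using \<phi> by (simp add: pd_class_def)
  have "continuous_on ({0..} \<times> cbox 0 pi) (\<lambda>(t, \<theta>). \<phi> (cos \<theta>) t * poly (usp a n) (cos \<theta>) * sin \<theta> ^ a)"
    unfolding case_prod_beta
    by (intro continuous_intros continuous_on_compose2[OF c, of _ "\<lambda>z. (cos (snd z), fst z)", simplified])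
       auto
  from integral_continuous_on_param[OF this] show ?thesis
    unfolding usp_coeff_def[abs_def] usp_int_def using usp_norm_gt_0[of a n]
    by (intro continuous_intros) auto
qed

lemma pderiv_usp_eq:
  "\<exists>c\<ge>0. \<exists>m. pderiv (usp a n) = smult c (usp (a + 2) m)"
proof (cases n)
  case 0
  then show ?thesis by (intro exI[of _ 0]) simp
next
  case (Suc m)
  then show ?thesis unfolding Suc pderiv_usp
    by (intro exI[of _ "real (Suc m) * real (Suc m + a) / real (a + 1)"]) auto
qed

lemma abs_pderiv_usp_le:
  assumes dim: "DIM('c::euclidean_space) = a + 4" and x: "x \<in> {-1..1}"
  shows "\<bar>poly (pderiv (usp a n)) x\<bar> \<le> poly (pderiv (usp a n)) 1"
proof -
  obtain c m where c: "c \<ge> 0" and eq: "pderiv (usp a n) = smult c (usp (a + 2) m)"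
    using pderiv_usp_eq by blast
  have dim': "DIM('c) = (a + 2) + 2" using dim by simp
  show ?thesis
    using mult_left_mono[OF abs_poly_usp_le_1[OF dim', of x m] c] x c
    by (simp add: eq abs_mult del: add_2_eq_Suc')
qed

lemma pderiv_usp_gram_nonneg:
  fixes p :: "nat \<Rightarrow> 'e::euclidean_space"
  assumes dim: "DIM('e) = a + 4" and p: "\<And>i. i < N \<Longrightarrow> p i \<in> sphere 0 1"
    and M: "\<And>b. 0 \<le> (\<Sum>i<N. \<Sum>j<N. b i * M i j * b j)"
  shows "0 \<le> (\<Sum>i<N. \<Sum>j<N. b i * (M i j * poly (pderiv (usp a n)) (p i \<bullet> p j)) * b j)"
proof -
  obtain c m where c: "c \<ge> 0" and eq: "pderiv (usp a n) = smult c (usp (a + 2) m)"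
    using pderiv_usp_eq by blast
  have dim': "DIM('e) = (a + 2) + 2" using dim by simp
  have "0 \<le> c * (\<Sum>i<N. \<Sum>j<N. b i * (M i j * poly (usp (a + 2) m) (p i \<bullet> p j)) * b j)"
    by (intro mult_nonneg_nonneg c usp_gram_nonneg[OF dim' p M])
  then show ?thesis by (simp add: eq sum_distrib_left mult_ac del: add_2_eq_Suc')
qed

text \<open>
  This is where the differentiability of \<open>\<phi>\<close> enters: at the point \<open>(1, 0)\<close>. Since all
  coefficients at \<open>t = 0\<close> are nonnegative and \<open>P\<^sub>n x \<le> P\<^sub>n 1\<close>, the difference of \<open>\<phi> x 0\<close> and a
  partial sum of the expansion is maximal at \<open>x = 1\<close>, so its derivative there is nonnegative.
  The second space \<open>'c\<close>, whose sphere has two more dimensions, serves to show that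
  \<open>P\<^sub>n' 1 \<ge> 0\<close>.
\<close>

lemma summable_usp_coeff_pderiv:
  assumes dim: "DIM('a::euclidean_space) = a + 2" and dim': "DIM('c::euclidean_space) = a + 4"
    and \<phi>: "\<phi> \<in> pd_class TYPE('a) TYPE('b::euclidean_space)"
    and diff: "(\<lambda>s. \<phi> s 0) differentiable (at 1 within {-1..1})"
  shows "summable (\<lambda>n. usp_coeff a \<phi> n 0 * poly (pderiv (usp a n)) 1)"
proof -
  let ?c = "\<lambda>n. usp_coeff a \<phi> n 0"
  obtain D where D: "((\<lambda>s. \<phi> s 0) has_real_derivative D) (at 1 within {-1..1})"
    using diff real_differentiable_def by blast
  note c0 = usp_coeff_nonneg[OF dim \<phi>]
  show ?thesis
  proof (rule summableI_nonneg_bounded[where x = D])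
    show "0 \<le> ?c n * poly (pderiv (usp a n)) 1" for n
      using c0[of n] abs_pderiv_usp_le[OF dim', of 1 n] by simp
    show "(\<Sum>n<N. ?c n * poly (pderiv (usp a n)) 1) \<le> D" for N
    proof -
      define r where "r x = \<phi> x 0 - (\<Sum>n<N. ?c n * poly (usp a n) x)" for x
      have "(r has_real_derivative (D - (\<Sum>n<N. ?c n * poly (pderiv (usp a n)) 1))) (at 1 within {-1..1})"
        unfolding r_def[abs_def]
        by (intro DERIV_diff D DERIV_sum DERIV_cmult has_field_derivative_at_within[OF poly_DERIV])
      then have lim: "((\<lambda>y. (r y - r 1) / (y - 1)) \<longlongrightarrow> D - (\<Sum>n<N. ?c n * poly (pderiv (usp a n)) 1))
          (at 1 within {-1..1})"
        by (simp add: has_field_derivative_iff)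
      have "r x \<le> r 1" if x: "x \<in> {-1..1}" for x
      proof -
        have s: "(\<lambda>n. ?c n * (1 - poly (usp a n) x)) sums (\<phi> 1 0 - \<phi> x 0)"
          using sums_diff[OF pd_class_expansion[OF dim \<phi>, of 1 0] pd_class_expansion[OF dim \<phi> x, of 0]]
          by (simp add: algebra_simps)
        have nn: "0 \<le> ?c n * (1 - poly (usp a n) x)" for n
          using c0[of n] abs_poly_usp_le_1[OF dim, of x n] x by (intro mult_nonneg_nonneg) auto
        have "(\<Sum>n<N. ?c n * (1 - poly (usp a n) x)) \<le> \<phi> 1 0 - \<phi> x 0"
          using sum_le_suminf[OF sums_summable[OF s], of "{..<N}"] nn sums_unique[OF s] by simp
        then show ?thesis by (simp add: r_def algebra_simps sum_subtractf)
      qed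
      then have "\<forall>\<^sub>F y in at 1 within {-1..1}. 0 \<le> (r y - r 1) / (y - 1)"
        by (auto simp: eventually_at_filter divide_nonpos_nonpos)
      moreover have "at 1 within {-1..1::real} \<noteq> bot"
        by (simp add: trivial_limit_within islimpt_Icc)
      ultimately have "0 \<le> D - (\<Sum>n<N. ?c n * poly (pderiv (usp a n)) 1)"
        by (intro tendsto_lowerbound[OF lim])
      then show ?thesis by simp
    qed
  qed
qed

section \<open>The derivative in the first variable\<close>

theorem theorem4p1:
  fixes d k :: nat and \<phi> :: "real \<Rightarrow> real \<Rightarrow> real"
  assumes "d > 0" and "k > 0"
    and "DIM('a::euclidean_space) = d + 1"
    and "DIM('c::euclidean_space) = (d + 2) + 1"
    and "DIM('b::euclidean_space) = k"
    and "\<phi> \<in> pd_class TYPE('a) TYPE('b)"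
    and "differentiable_in_first \<phi>"
  shows "D1 \<phi> \<in> pd_class TYPE('c) TYPE('b)"
proof -
  define a where "a = d - 1"
  have dim: "DIM('a) = a + 2" and dim': "DIM('c) = a + 4"
    using assms(1,3,4) by (auto simp: a_def)
  note \<phi> = assms(6)
  define c where "c = usp_coeff a \<phi>"
  let ?P' = "\<lambda>n. poly (pderiv (usp a n))"
  have "(\<lambda>s. \<phi> s 0) differentiable (at 1 within {-1..1})"
    using assms(7) by (auto simp: differentiable_in_first_def differentiable_on_def)
  then have M: "summable (\<lambda>n. c n 0 * ?P' n 1)"
    unfolding c_def by (rule summable_usp_coeff_pderiv[OF dim dim' \<phi>])
  \<comment> \<open>A majorant for all \<open>x\<close> and \<open>t\<close> at once, so that the differentiated series converges uniformly.\<close>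
  have bound: "\<bar>c n t * ?P' n x\<bar> \<le> c n 0 * ?P' n 1" if "x \<in> {-1..1}" "0 \<le> t" for n x t
    unfolding abs_mult c_def
    using usp_coeff_nonneg[OF dim \<phi>, of n]
    by (intro mult_mono abs_usp_coeff_le[OF dim \<phi>] abs_pderiv_usp_le[OF dim'] that) auto
  have D1: "D1 \<phi> x t = (\<Sum>n. c n t * ?P' n x)" if x: "x \<in> {-1..1}" and t: "0 \<le> t" for x t
  proof -
    note expansion = pd_class_expansion[OF dim \<phi> _ t, folded c_def]
    have "\<exists>g. \<forall>x\<in>{-1..1}. (\<lambda>n. c n t * poly (usp a n) x) sums g x \<and>
        (g has_field_derivative (\<Sum>n. c n t * ?P' n x)) (at x within {-1..1})"
    proof (rule has_field_derivative_series)
      show "uniform_limit {-1..1} (\<lambda>N x. \<Sum>n<N. c n t * ?P' n x) (\<lambda>x. \<Sum>n. c n t * ?P' n x) sequentially"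
        by (rule Weierstrass_m_test[OF _ M]) (use bound t in auto)
      show "((\<lambda>x. c n t * poly (usp a n) x) has_field_derivative c n t * ?P' n x) (at x within {-1..1})"
        for n x by (intro DERIV_cmult has_field_derivative_at_within[OF poly_DERIV])
      show "summable (\<lambda>n. c n t * poly (usp a n) x)"
        using expansion[OF x] by (rule sums_summable)
    qed (use x in auto)
    then obtain g where g: "\<And>x. x \<in> {-1..1} \<Longrightarrow> (\<lambda>n. c n t * poly (usp a n) x) sums g x"
      "\<And>x. x \<in> {-1..1} \<Longrightarrow> (g has_field_derivative (\<Sum>n. c n t * ?P' n x)) (at x within {-1..1})"
      by blast
    have "((\<lambda>x. \<phi> x t) has_field_derivative (\<Sum>n. c n t * ?P' n x)) (at x within {-1..1})"
      by (rule has_field_derivative_transform_within[OF g(2)[OF x] zero_less_one x])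
         (use sums_unique2[OF g(1) expansion] in auto)
    then show ?thesis
      unfolding D1_def using x
      by (intro vector_derivative_within_closed_interval)
         (auto simp: has_real_derivative_iff_has_vector_derivative)
  qed
  have sm: "summable (\<lambda>n. c n t * ?P' n x)" if "x \<in> {-1..1}" "0 \<le> t" for x t
    by (rule summable_comparison_test'[OF M, of 0]) (use bound[OF that] in simp)
  have "continuous_on ({-1..1} \<times> {0..}) (\<lambda>(x, t). D1 \<phi> x t)"
  proof -
    have lim: "uniform_limit ({-1..1} \<times> {0..}) (\<lambda>N z. \<Sum>n<N. c n (snd z) * ?P' n (fst z))
        (\<lambda>z. \<Sum>n. c n (snd z) * ?P' n (fst z)) sequentially"
      by (rule Weierstrass_m_test[OF _ M]) (use bound in auto)
    have "continuous_on ({-1..1} \<times> {0..}) (\<lambda>z. c n (snd z))" for n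
      unfolding c_def
      by (rule continuous_on_compose2[OF continuous_on_usp_coeff[OF \<phi>]]) (auto intro: continuous_intros)
    then have "continuous_on ({-1..1} \<times> {0..}) (\<lambda>z. \<Sum>n. c n (snd z) * ?P' n (fst z))"
      by (intro uniform_limit_theorem[OF _ lim] always_eventually allI continuous_intros) auto
    then show ?thesis
      by (rule continuous_on_eq) (auto simp: D1)
  qed
  moreover have "positive_definite_on (sphere (0::'c) 1 \<times> (UNIV::'b set))
       (\<lambda>(x, y) (x', y'). D1 \<phi> (cos (geodist x x')) (norm (y - y')))"
    unfolding positive_definite_on_def
  proof (intro allI impI)
    fix N and b :: "nat \<Rightarrow> real" and p :: "nat \<Rightarrow> 'c \<times> 'b"
    assume p: "\<forall>i<N. p i \<in> sphere 0 1 \<times> UNIV"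
    define x y where "x i = fst (p i)" and "y i = snd (p i)" for i
    have x: "x i \<in> sphere 0 1" if "i < N" for i using p that by (auto simp: x_def mem_Times_iff)
    have inner: "x i \<bullet> x j \<in> {-1..1}" if "i < N" "j < N" for i j
      using Cauchy_Schwarz_ineq2[of "x i" "x j"] x that by (auto simp: abs_le_iff)
    have "(\<Sum>i<N. \<Sum>j<N. b i * (case p i of (x, y) \<Rightarrow> \<lambda>(x', y'). D1 \<phi> (cos (geodist x x')) (norm (y - y'))) (p j) * b j)
        = (\<Sum>i<N. \<Sum>j<N. \<Sum>n. b i * (c n (norm (y i - y j)) * ?P' n (x i \<bullet> x j)) * b j)"
    proof (intro sum.cong refl)
      fix i j assume ij: "i \<in> {..<N}" "j \<in> {..<N}"
      then have "cos (geodist (x i) (x j)) = x i \<bullet> x j" by (intro cos_geodist x) auto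
      then show "b i * (case p i of (x, y) \<Rightarrow> \<lambda>(x', y'). D1 \<phi> (cos (geodist x x')) (norm (y - y'))) (p j) * b j
          = (\<Sum>n. b i * (c n (norm (y i - y j)) * ?P' n (x i \<bullet> x j)) * b j)"
        using ij inner[of i j] sm[of "x i \<bullet> x j" "norm (y i - y j)"]
        by (simp add: case_prod_beta x_def y_def D1 suminf_mult suminf_mult2[symmetric] summable_mult)
    qed
    also have "\<dots> = (\<Sum>n. \<Sum>i<N. \<Sum>j<N. b i * (c n (norm (y i - y j)) * ?P' n (x i \<bullet> x j)) * b j)"
      by (subst suminf_sum, (intro summable_sum summable_mult summable_mult2 sm inner; simp),
          intro sum.cong refl, subst suminf_sum, (intro summable_mult summable_mult2 sm inner; simp), simp)
    also have "\<dots> \<ge> 0"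
    proof (rule suminf_nonneg)
      show "summable (\<lambda>n. \<Sum>i<N. \<Sum>j<N. b i * (c n (norm (y i - y j)) * ?P' n (x i \<bullet> x j)) * b j)"
        by (intro summable_sum summable_mult summable_mult2 sm inner) auto
      show "0 \<le> (\<Sum>i<N. \<Sum>j<N. b i * (c n (norm (y i - y j)) * ?P' n (x i \<bullet> x j)) * b j)" for n
        unfolding c_def by (intro pderiv_usp_gram_nonneg[OF dim'] x usp_coeff_pd[OF dim \<phi>]) auto
    qed
    finally show "0 \<le> (\<Sum>i<N. \<Sum>j<N. b i * (case p i of (x, y) \<Rightarrow> \<lambda>(x', y'). D1 \<phi> (cos (geodist x x')) (norm (y - y'))) (p j) * b j)" .
  qed
  ultimately show ?thesis by (simp add: pd_class_def)
qed

end
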